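(* Let $X_1,X_2,\dots$ be i.i.d. with a monotone decreasing probability mass function $p$ on $\mathbb N$. Suppose that for some $r,s\in\mathbb N$ with $s-r\ge1$ we have $p_{r-1}>p_r=\dots=p_s>p_{s+1}$ (with the convention $p_{-1}=+\infty$, so that the first inequality is vacuous when $r=0$). Then, as $n\to\infty$, in distribution in $\mathbb R^{s-r+1}$, $$(Y_n^R)^{(r,s)}\to_d\mathrm{rear}(Y^{(r,s)}),\qquad(Y_n^G)^{(r,s)}\to_d\mathrm{gren}(Y^{(r,s)}).$$
   Context: $\mathbb N=\{0,1,2,\dots\}$. $p$ is monotone decreasing if $p_x\ge p_{x+1}$ for all $x\in\mathbb N$. The empirical estimator is $\widehat p_{n,x}=n^{-1}\#\{i\le n:X_i=x\}$. For a finite vector $w=(w_0,\dots,w_k)$, $\mathrm{rear}(w)$ is the vector of entries of $w$ sorted in nonincreasing order, and $\mathrm{gren}(w)$ is the vector of the $k+1$ left slopes, at $j=0,\dots,k$, of the least concave majorant of the points $\{(j,\sum_{i=0}^jw_i):j=-1,0,\dots,k\}$ (empty sum $=0$). For a vector indexed by $r,\dots,s$ these are defined in the same way after shifting indices, the result again being indexed by $r,\dots,s$. The rearrangement estimator is $\widehat p_n^R=\mathrm{rear}(\widehat p_n)$ and the Grenander estimator (MLE) is $\widehat p_n^G=\mathrm{gren}(\widehat p_n)$; both operators are applied to the finite vector $(\widehat p_{n,x})_{0\le x\le\max_{i\le n}X_i}$, and the results are extended by $0$ to $\mathbb N$. Fluctuation processes: $Y_{n,x}^R=\sqrt n(\widehat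 p_{n,x}^R-p_x)$, $Y_{n,x}^G=\sqrt n(\widehat p_{n,x}^G-p_x)$. $Y=(Y_x)_{x\in\mathbb N}$ is the mean-zero Gaussian process in $\ell_2$ with $\mathrm{cov}(Y_x,Y_{x'})=p_x\delta_{x,x'}-p_xp_{x'}$. For a sequence $v$, $v^{(r,s)}=(v_r,v_{r+1},\dots,v_s)$. *)

theory Defs
  imports "HOL-Probability.Probability" "HOL-Library.More_List"
begin

text \<open>A finite vector \<open>(w\<^sub>0, \<dots>, w\<^sub>k)\<close> is a list of length \<open>k + 1\<close>.\<close>

definition rear :: "real list \<Rightarrow> real list" where
  "rear w = rev (sort w)"

text \<open>
  Since concavity is imposed on \<open>D\<close> only, the value is meaningful for \<open>t \<in> D\<close> only.
\<close>

definition least_concave_majorant :: "real set \<Rightarrow> (real \<times> real) set \<Rightarrow> real \<Rightarrow> real" where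
  "least_concave_majorant D P t =
     (INF g \<in> {g. concave_on D g \<and> (\<forall>(x, y)\<in>P. y \<le> g x)}. g t)"

definition left_slope :: "(real \<Rightarrow> real) \<Rightarrow> real \<Rightarrow> real" where
  "left_slope f x = vector_derivative f (at_left x)"

text \<open>
  The points \<open>(j, w\<^sub>0 + \<dots> + w\<^sub>j)\<close> for \<open>j = -1, \<dots>, k\<close>; here \<open>m = j + 1\<close> counts the summands,
  so that \<open>m = 0\<close> gives the point \<open>(-1, 0)\<close>.
\<close>

definition cumsum_points :: "real list \<Rightarrow> (real \<times> real) set" where
  "cumsum_points w = {(real m - 1, \<Sum>i<m. w ! i) | m. m \<le> length w}"

definition gren :: "real list \<Rightarrow> real list" where
  "gren w = map (\<lambda>j. left_slope
       (least_concave_majorant {-1 .. real (length w) - 1} (cumsum_points w)) (real j))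
     [0..<length w]"

text \<open>
  The vector \<open>(v\<^sub>r, \<dots>, v\<^sub>s)\<close>, indexed by \<open>r, \<dots>, s\<close>, is an element of \<open>\<real>\<close> to the power
  \<open>{r..s}\<close>, i.e. an extensional function on \<open>{r..s}\<close>. An operator on lists acts on it by shifting
  the indices to \<open>0, \<dots>, s - r\<close> and back.
\<close>

definition segment :: "nat \<Rightarrow> nat \<Rightarrow> (nat \<Rightarrow> real) \<Rightarrow> nat \<Rightarrow> real" where
  "segment r s v = restrict v {r..s}"

definition on_segment ::
  "(real list \<Rightarrow> real list) \<Rightarrow> nat \<Rightarrow> nat \<Rightarrow> (nat \<Rightarrow> real) \<Rightarrow> nat \<Rightarrow> real" where
  "on_segment F r s v = (\<lambda>x\<in>{r..s}. F (map v [r..<Suc s]) ! (x - r))"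

text \<open>
  The sample is \<open>X\<^sub>1, \<dots>, X\<^sub>n\<close>; the value \<open>X 0\<close> is never used. For \<open>n = 0\<close> there is no maximal
  observation and the estimators are junk values, which does not affect limits as \<open>n\<close> tends to
  infinity.
\<close>

definition empirical :: "(nat \<Rightarrow> 'a \<Rightarrow> nat) \<Rightarrow> nat \<Rightarrow> 'a \<Rightarrow> nat \<Rightarrow> real" where
  "empirical X n \<omega> x = real (card {i \<in> {1..n}. X i \<omega> = x}) / real n"

definition empirical_vector :: "(nat \<Rightarrow> 'a \<Rightarrow> nat) \<Rightarrow> nat \<Rightarrow> 'a \<Rightarrow> real list" where
  "empirical_vector X n \<omega> = map (empirical X n \<omega>) [0..<Suc (MAX i\<in>{1..n}. X i \<omega>)]"

definition rearrangement_estimator :: "(nat \<Rightarrow> 'a \<Rightarrow> nat) \<Rightarrow> nat \<Rightarrow> 'a \<Rightarrow> nat \<Rightarrow> real" where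
  "rearrangement_estimator X n \<omega> = nth_default 0 (rear (empirical_vector X n \<omega>))"

definition grenander_estimator :: "(nat \<Rightarrow> 'a \<Rightarrow> nat) \<Rightarrow> nat \<Rightarrow> 'a \<Rightarrow> nat \<Rightarrow> real" where
  "grenander_estimator X n \<omega> = nth_default 0 (gren (empirical_vector X n \<omega>))"

definition fluctuation ::
  "(nat \<Rightarrow> 'a \<Rightarrow> nat \<Rightarrow> real) \<Rightarrow> nat pmf \<Rightarrow> nat \<Rightarrow> 'a \<Rightarrow> nat \<Rightarrow> real" where
  "fluctuation est p n \<omega> x = sqrt (real n) * (est n \<omega> x - pmf p x)"

context prob_space
begin

definition covariance :: "('a \<Rightarrow> real) \<Rightarrow> ('a \<Rightarrow> real) \<Rightarrow> real" where
  "covariance U V = expectation (\<lambda>\<omega>. (U \<omega> - expectation U) * (V \<omega> - expectation V))"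

text \<open>
  Degenerate (constant) Gaussian variables have to be allowed: for instance \<open>Y\<^sub>x = 0\<close> almost
  surely whenever \<open>p\<^sub>x = 0\<close>.
\<close>

definition gaussian_variable :: "('a \<Rightarrow> real) \<Rightarrow> bool" where
  "gaussian_variable U \<longleftrightarrow> random_variable borel U \<and>
     ((\<exists>\<mu> \<sigma>. \<sigma> > 0 \<and> distributed M lborel U (normal_density \<mu> \<sigma>)) \<or>
      (\<exists>\<mu>. AE \<omega> in M. U \<omega> = \<mu>))"

definition gaussian_process :: "('i \<Rightarrow> 'a \<Rightarrow> real) \<Rightarrow> bool" where
  "gaussian_process Y \<longleftrightarrow>
     (\<forall>J a. finite J \<longrightarrow> gaussian_variable (\<lambda>\<omega>. \<Sum>x\<in>J. a x * Y x \<omega>))"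

end

text \<open>
  Convergence in distribution of random vectors with values in \<open>\<real>\<close> to the power \<open>J\<close>, for a
  finite index set \<open>J\<close>: expectations of bounded continuous functions converge. The limit may live
  on a different probability space.
\<close>

definition converges_in_distribution ::
  "'i set \<Rightarrow> 'a measure \<Rightarrow> (nat \<Rightarrow> 'a \<Rightarrow> 'i \<Rightarrow> real) \<Rightarrow> 'b measure \<Rightarrow> ('b \<Rightarrow> 'i \<Rightarrow> real) \<Rightarrow> bool" where
  "converges_in_distribution J M Z N Z' \<longleftrightarrow>
     (\<forall>n. Z n \<in> M \<rightarrow>\<^sub>M PiM J (\<lambda>_. borel)) \<and> Z' \<in> N \<rightarrow>\<^sub>M PiM J (\<lambda>_. borel) \<and>
     (\<forall>f. continuous_map (product_topology (\<lambda>_. euclideanreal) J) euclideanreal f \<and>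
          bounded (f ` (\<Pi>\<^sub>E i\<in>J. UNIV)) \<longrightarrow>
          (\<lambda>n. \<integral>\<omega>. f (Z n \<omega>) \<partial>M) \<longlonglongrightarrow> (\<integral>\<omega>. f (Z' \<omega>) \<partial>N))"

end

theory Submission
  imports Defs
begin

text \<open>
  Both \<^const>\<open>rear\<close> and \<^const>\<open>gren\<close> are monotone, commute with increasing affine maps, and split over
  \<open>u @ v\<close> whenever all entries of \<open>u\<close> dominate those of \<open>v\<close>. Since \<open>p\<close> drops strictly before \<open>r\<close>
  and after \<open>s\<close>, the splitting property shows that as soon as \<open>\<bar>empirical - p\<bar>\<close> is uniformly small, an
  event whose probability tends to 1 by a union of Chebyshev bounds, the estimator on \<open>{r..s}\<close> depends
  only on the empirical frequencies on \<open>{r..s}\<close>; as \<open>p\<close> is constant there, affine equivariance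
  identifies its fluctuations with the operator applied to the empirical fluctuations. Monotonicity
  and translation equivariance make the operator Lipschitz, so the multivariate central limit
  theorem and continuous mapping conclude.

  The multivariate central limit theorem is obtained from the one-dimensional one by convergence of
  all \<open>E cos (b + \<langle>a, Z\<^sub>n\<rangle>)\<close>, uniform approximation by trigonometric polynomials on a torus
  (Stone-Weierstrass) and bounded second moments.
\<close>

subsection \<open>Rearrangement and Grenander operators\<close>

locale isotone_operator =
  fixes F :: "real list \<Rightarrow> real list"
  assumes length_F [simp]: "length (F w) = length w"
    and F_append: "(\<And>x y. x \<in> set u \<Longrightarrow> y \<in> set v \<Longrightarrow> y \<le> x) \<Longrightarrow> F (u @ v) = F u @ F v"
    and F_mono: "list_all2 (\<le>) u v \<Longrightarrow> list_all2 (\<le>) (F u) (F v)"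
    and F_affine: "c > 0 \<Longrightarrow> F (map (\<lambda>x. c * x + d) w) = map (\<lambda>x. c * x + d) (F w)"

lemma rev_sorted_nth_ge_iff:
  fixes ys :: "real list"
  assumes "sorted (rev ys)" "k < length ys"
  shows "ys ! k \<ge> t \<longleftrightarrow> k < length (filter (\<lambda>y. y \<ge> t) ys)"
proof -
  have anti: "ys ! j \<le> ys ! i" if "i \<le> j" "j < length ys" for i j
    using assms(1) that by (simp add: sorted_rev_iff_nth_mono)
  show ?thesis
  proof
    assume "ys ! k \<ge> t"
    then have "{..k} \<subseteq> {i. i < length ys \<and> ys ! i \<ge> t}"
      using assms(2) anti by (fastforce intro: order_trans)
    then have "card {..k} \<le> card {i. i < length ys \<and> ys ! i \<ge> t}"
      by (intro card_mono) auto
    then show "k < length (filter (\<lambda>y. y \<ge> t) ys)"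
      by (simp add: length_filter_conv_card)
  next
    assume k: "k < length (filter (\<lambda>y. y \<ge> t) ys)"
    show "ys ! k \<ge> t"
    proof (rule ccontr)
      assume "\<not> ys ! k \<ge> t"
      then have "{i. i < length ys \<and> ys ! i \<ge> t} \<subseteq> {..<k}"
        using anti by (force simp: not_less[symmetric] intro: order_trans)
      then have "card {i. i < length ys \<and> ys ! i \<ge> t} \<le> card {..<k}"
        by (intro card_mono) auto
      then show False
        using k by (simp add: length_filter_conv_card)
    qed
  qed
qed

lemma length_filter_mono_list_all2:
  fixes u v :: "real list"
  assumes "list_all2 (\<le>) u v"
  shows "length (filter (\<lambda>y. y \<ge> t) u) \<le> length (filter (\<lambda>y. y \<ge> t) v)"
  using assms by (induction rule: list_all2_induct) auto

lemma mset_rear [simp]: "mset (rear w) = mset w"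
  by (simp add: rear_def)

lemma rear_mono:
  assumes "list_all2 (\<le>) u v"
  shows "list_all2 (\<le>) (rear u) (rear v)"
proof -
  have *: "length (filter P (rear w)) = length (filter P w)" for P w
    by (metis mset_filter mset_rear size_mset)
  have len: "length u = length v"
    using assms by (rule list_all2_lengthD)
  have "rear u ! k \<le> rear v ! k" if k: "k < length u" for k
  proof -
    have "k < length (filter (\<lambda>y. y \<ge> rear u ! k) (rear u))"
      using rev_sorted_nth_ge_iff[of "rear u" k "rear u ! k"] k by (simp add: rear_def)
    also have "\<dots> \<le> length (filter (\<lambda>y. y \<ge> rear u ! k) (rear v))"
      unfolding * by (rule length_filter_mono_list_all2[OF assms])
    finally show ?thesis
      using rev_sorted_nth_ge_iff[of "rear v" k "rear u ! k"] k len by (simp add: rear_def)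
  qed
  then show ?thesis
    using len by (auto simp: list_all2_conv_all_nth rear_def)
qed

interpretation rear: isotone_operator rear
proof
  show "length (rear w) = length w" for w
    by (simp add: rear_def)
  show "rear (u @ v) = rear u @ rear v" if "\<And>x y. x \<in> set u \<Longrightarrow> y \<in> set v \<Longrightarrow> y \<le> x" for u v
  proof -
    have "sort (u @ v) = sort v @ sort u"
      by (rule properties_for_sort) (use that in \<open>auto simp: sorted_append\<close>)
    then show ?thesis by (simp add: rear_def)
  qed
  show "rear (map (\<lambda>x. c * x + d) w) = map (\<lambda>x. c * x + d) (rear w)" if "c > 0" for c d w
  proof -
    have "sort (map (\<lambda>x. c * x + d) w) = map (\<lambda>x. c * x + d) (sort w)"
      by (rule properties_for_sort)
         (use that in \<open>auto simp: sorted_map intro: sorted_wrt_mono_rel[of _ "(\<le>)"]\<close>)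
    then show ?thesis by (simp add: rear_def rev_map)
  qed
qed (fact rear_mono)

text \<open>
  These conditions characterise the least concave majorant of the partial sums of \<open>w\<close>: its slopes \<open>h\<close>
  decrease, it lies above the partial sums, and it touches them at both ends and wherever its slope
  drops.
\<close>

definition majorant_slopes :: "nat \<Rightarrow> (nat \<Rightarrow> real) \<Rightarrow> (nat \<Rightarrow> real) \<Rightarrow> bool" where
  "majorant_slopes n w h \<longleftrightarrow>
     (\<forall>i j. i \<le> j \<and> j < n \<longrightarrow> h j \<le> h i) \<and>
     (\<forall>m\<le>n. sum w {..<m} \<le> sum h {..<m}) \<and>
     (\<forall>m\<le>n. m = 0 \<or> m = n \<or> h m < h (m - 1) \<longrightarrow> sum w {..<m} = sum h {..<m})"

lemma majorant_slopesD:
  assumes "majorant_slopes n w h"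
  shows "i \<le> j \<Longrightarrow> j < n \<Longrightarrow> h j \<le> h i"
    and "m \<le> n \<Longrightarrow> sum w {..<m} \<le> sum h {..<m}"
    and "sum w {..<n} = sum h {..<n}"
    and "m \<le> n \<Longrightarrow> h m < h (m - 1) \<Longrightarrow> sum w {..<m} = sum h {..<m}"
  using assms by (auto simp: majorant_slopes_def)

lemma majorant_slopes_contact:
  assumes h: "majorant_slopes n w h" and "j < n"
  obtains a b where "a \<le> j" "j < b" "b \<le> n" "sum w {..<a} = sum h {..<a}"
    "sum w {..<b} = sum h {..<b}" "\<And>i. a \<le> i \<Longrightarrow> i < b \<Longrightarrow> h i = h j"
proof -
  define a where "a = (LEAST i. h i = h j)"
  define b where "b = Suc (GREATEST i. i < n \<and> h i = h j)"
  have a: "h a = h j" "a \<le> j"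
    unfolding a_def by (auto intro: LeastI Least_le)
  have b': "b - 1 < n \<and> h (b - 1) = h j"
    unfolding b_def using GreatestI_nat[of "\<lambda>i. i < n \<and> h i = h j" j n] \<open>j < n\<close> by auto
  have b: "i < b" if "i < n" "h i = h j" for i
    unfolding b_def using Greatest_le_nat[of "\<lambda>i. i < n \<and> h i = h j" i n] that by auto
  have "sum w {..<a} = sum h {..<a}"
  proof (cases "a = 0")
    case False
    then have "h (a - 1) \<noteq> h j"
      using not_less_Least[of "a - 1" "\<lambda>i. h i = h j"] by (auto simp: a_def)
    moreover have "h a \<le> h (a - 1)"
      using majorant_slopesD(1)[OF h, of "a - 1" a] a \<open>j < n\<close> by simp
    ultimately show ?thesis
      using majorant_slopesD(4)[OF h, of a] a \<open>j < n\<close> by simp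
  qed simp
  moreover have "sum w {..<b} = sum h {..<b}"
  proof (cases "b < n")
    case True
    then have "h b \<noteq> h j" "h b \<le> h (b - 1)"
      using b majorant_slopesD(1)[OF h, of "b - 1" b] by auto
    then show ?thesis
      using majorant_slopesD(4)[OF h, of b] b' True by simp
  next
    case False
    then have "b = n" using b' b_def by auto
    then show ?thesis using majorant_slopesD(3)[OF h] by simp
  qed
  moreover have "h i = h j" if "a \<le> i" "i < b" for i
    using majorant_slopesD(1)[OF h, of a i] majorant_slopesD(1)[OF h, of i "b - 1"] a b' that
    by (intro antisym) auto
  moreover have "b \<le> n"
    using b' by (simp add: b_def)
  ultimately show ?thesis
    using that[of a b] a(2) b[OF \<open>j < n\<close> refl] by blast
qed

lemma sum_lessThan_add:
  fixes f :: "nat \<Rightarrow> real"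
  shows "sum f {..<k + l} = sum f {..<k} + (\<Sum>i<l. f (i + k))"
  by (induction l) (auto simp: add_ac)

lemma sum_lessThan_append:
  fixes f g :: "nat \<Rightarrow> real"
  shows "(\<Sum>i<m. if i < k then f i else g (i - k)) = sum f {..<min m k} + sum g {..<m - k}"
proof (cases "m \<le> k")
  case False
  then obtain l where "m = k + l" by (metis le_Suc_ex nat_le_linear)
  then show ?thesis by (simp add: sum_lessThan_add)
qed (simp add: min_absorb1)

lemma majorant_slopes_append:
  assumes f: "majorant_slopes k u f" and g: "majorant_slopes l v g"
    and fg: "k > 0 \<Longrightarrow> l > 0 \<Longrightarrow> g 0 \<le> f (k - 1)"
  shows "majorant_slopes (k + l) (\<lambda>i. if i < k then u i else v (i - k))
           (\<lambda>i. if i < k then f i else g (i - k))"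
proof -
  have anti_mixed: "g (j - k) \<le> f i" if "i < k" "k \<le> j" "j < k + l" for i j
  proof -
    have "g (j - k) \<le> g 0" "f (k - 1) \<le> f i"
      using majorant_slopesD(1)[OF g, of 0 "j - k"] majorant_slopesD(1)[OF f, of i "k - 1"] that
      by auto
    then show ?thesis using fg that by simp
  qed
  have contact: "sum u {..<min m k} + sum v {..<m - k} = sum f {..<min m k} + sum g {..<m - k}"
    if "m \<le> k + l" "m = 0 \<or> m = k + l \<or>
      (if m < k then f m else g (m - k)) < (if m - 1 < k then f (m - 1) else g (m - 1 - k))" for m
  proof -
    consider "m = 0" | "m = k + l" | "0 < m" "m < k" | "m = k" "m > 0" | "k < m" "m < k + l"
      using \<open>m \<le> k + l\<close> by linarith
    then show ?thesis
    proof cases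
      case 2
      then show ?thesis using majorant_slopesD(3)[OF f] majorant_slopesD(3)[OF g] by simp
    next
      case 3
      then have "f m < f (m - 1)" using that by (auto split: if_splits)
      then show ?thesis using 3 majorant_slopesD(4)[OF f, of m] by simp
    next
      case 4
      then show ?thesis using majorant_slopesD(3)[OF f] by simp
    next
      case 5
      then have "m - 1 - k = m - k - 1" "\<not> m - 1 < k" by auto
      then have "g (m - k) < g (m - k - 1)" using that 5 by auto
      then show ?thesis
        using 5 majorant_slopesD(4)[OF g, of "m - k"] majorant_slopesD(3)[OF f] by simp
    qed simp
  qed
  have le: "sum u {..<min m k} + sum v {..<m - k} \<le> sum f {..<min m k} + sum g {..<m - k}"
    if "m \<le> k + l" for m
    using majorant_slopesD(2)[OF f, of "min m k"] majorant_slopesD(2)[OF g, of "m - k"] that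
    by (intro add_mono) auto
  have "(if j < k then f j else g (j - k)) \<le> (if i < k then f i else g (i - k))"
    if "i \<le> j" "j < k + l" for i j
    using anti_mixed[of i j] majorant_slopesD(1)[OF f, of i j]
      majorant_slopesD(1)[OF g, of "i - k" "j - k"] that
    by (cases "i < k"; cases "j < k") auto
  then show ?thesis
    unfolding majorant_slopes_def sum_lessThan_append using contact le by blast
qed

text \<open>
  The first linear piece ends at a prefix of maximal average; the remaining pieces come from the
  rest of the vector.
\<close>

lemma ex_majorant_slopes: "\<exists>h. majorant_slopes n w h"
proof (induction n arbitrary: w rule: less_induct)
  case (less n)
  show ?case
  proof (cases "n = 0")
    case False
    define A where "A m = sum w {..<m} / real m" for m
    obtain b where b: "b \<in> {1..n}" "\<And>m. m \<in> {1..n} \<Longrightarrow> A m \<le> A b"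
      using ex_is_arg_min_if_finite[of "{1..n}" "\<lambda>m. - A m"] False
      by (auto simp: is_arg_min_def not_less)
    define c where "c = A b"
    have Wb: "sum w {..<b} = real b * c"
      using b by (simp add: c_def A_def)
    have W: "sum w {..<m} \<le> real m * c" if "m \<le> n" for m
      using b(2)[of m] that by (cases "m = 0") (auto simp: c_def A_def field_simps)
    obtain g where g: "majorant_slopes (n - b) (\<lambda>i. w (i + b)) g"
      using less.IH[of "n - b"] b False by auto
    have "g 0 \<le> c" if "n - b > 0"
    proof -
      obtain a b' where ab: "a \<le> 0" "0 < b'" "b' \<le> n - b"
          "(\<Sum>i<b'. w (i + b)) = sum g {..<b'}" "\<And>i. a \<le> i \<Longrightarrow> i < b' \<Longrightarrow> g i = g 0"
        using majorant_slopes_contact[OF g \<open>n - b > 0\<close>] by metis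
      have "sum g {..<b'} = (\<Sum>i<b'. g 0)"
        by (intro sum.cong refl ab(5)) (use ab(1) in auto)
      then have "real b' * g 0 = (\<Sum>i<b'. w (i + b))"
        using ab(4) by simp
      also have "\<dots> = sum w {..<b + b'} - sum w {..<b}"
        by (simp add: sum_lessThan_add)
      also have "\<dots> \<le> real b' * c"
        using W[of "b + b'"] ab(3) b(1) Wb by (auto simp: algebra_simps)
      finally show ?thesis using ab(2) by simp
    qed
    moreover have "majorant_slopes b w (\<lambda>_. c)"
      using W Wb b by (auto simp: majorant_slopes_def)
    ultimately have "\<exists>h. majorant_slopes (b + (n - b))
        (\<lambda>i. if i < b then w i else w (i - b + b)) h"
      using majorant_slopes_append[OF _ g, of b w "\<lambda>_. c"] by auto
    moreover have "(\<lambda>i. if i < b then w i else w (i - b + b)) = w"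
      by auto
    ultimately show ?thesis using b by simp
  qed (auto simp: majorant_slopes_def)
qed

lemma majorant_slopes_tangent:
  assumes h: "majorant_slopes n w h" and "j < n" "m \<le> n"
  shows "sum h {..<m} \<le> sum h {..<j} + h j * (real m - real j)"
proof (cases "j \<le> m")
  case True
  then obtain l where m: "m = j + l" by (metis le_Suc_ex)
  have "(\<Sum>i<l. h (i + j)) \<le> (\<Sum>i<l. h j)"
    by (intro sum_mono majorant_slopesD(1)[OF h]) (use m assms in auto)
  then show ?thesis by (simp add: m sum_lessThan_add mult.commute)
next
  case False
  then obtain l where j: "j = m + l" by (metis le_Suc_ex nat_le_linear)
  have "(\<Sum>i<l. h j) \<le> (\<Sum>i<l. h (i + m))"
    by (intro sum_mono majorant_slopesD(1)[OF h]) (use j assms in auto)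
  then show ?thesis
    using sum_lessThan_add[of h m l] by (simp add: j algebra_simps)
qed

lemma least_concave_majorant_eq:
  fixes w :: "real list" and j :: nat and t :: real
  defines "n \<equiv> length w"
  assumes h: "majorant_slopes n (nth w) h" and "j < n" and t: "real j - 1 \<le> t" "t \<le> real j"
  shows "least_concave_majorant {-1 .. real n - 1} (cumsum_points w) t
           = sum h {..<j} + h j * (t + 1 - real j)"
proof -
  let ?D = "{-1 .. real n - 1}"
  let ?G = "{g. concave_on ?D g \<and> (\<forall>(x, y)\<in>cumsum_points w. y \<le> g x)}"
  define L where "L = (\<lambda>x. sum h {..<j} + h j * (x + 1 - real j))"
  have majorant: "(\<forall>(x, y)\<in>cumsum_points w. y \<le> g x) \<longleftrightarrow>
      (\<forall>m\<le>n. sum (nth w) {..<m} \<le> g (real m - 1))" for g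
    by (auto simp: cumsum_points_def n_def)
  have "concave_on ?D L"
    unfolding concave_on_def convex_on_def L_def
  proof (intro conjI allI impI ballI)
    fix u v x y :: real assume "u + v = 1"
    then have v: "v = 1 - u" by simp
    show "- (sum h {..<j} + h j * (u *\<^sub>R x + v *\<^sub>R y + 1 - real j)) \<le>
       u * - (sum h {..<j} + h j * (x + 1 - real j)) + v * - (sum h {..<j} + h j * (y + 1 - real j))"
      unfolding v by (simp add: algebra_simps)
  qed simp
  moreover have "sum (nth w) {..<m} \<le> L (real m - 1)" if "m \<le> n" for m
    using majorant_slopes_tangent[OF h \<open>j < n\<close> that] majorant_slopesD(2)[OF h that]
    by (simp add: L_def)
  ultimately have L: "L \<in> ?G"
    by (simp add: majorant)
  moreover have "L t \<le> g t" if "g \<in> ?G" for g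
  proof -
    obtain a b where ab: "a \<le> j" "j < b" "b \<le> n" "sum (nth w) {..<a} = sum h {..<a}"
        "sum (nth w) {..<b} = sum h {..<b}" "\<And>i. a \<le> i \<Longrightarrow> i < b \<Longrightarrow> h i = h j"
      using majorant_slopes_contact[OF h \<open>j < n\<close>] by metis
    have H: "sum h {..<m} = sum h {..<a} + h j * (real m - real a)" if "a \<le> m" "m \<le> b" for m
    proof -
      obtain l where "m = a + l" using \<open>a \<le> m\<close> by (metis le_Suc_ex)
      then show ?thesis using ab(6) that by (simp add: sum_lessThan_add mult.commute)
    qed
    define \<theta> where "\<theta> = (t + 1 - real a) / (real b - real a)"
    have \<theta>: "0 \<le> \<theta>" "\<theta> \<le> 1" "\<theta> * (real b - real a) = t + 1 - real a"
      using t ab(1,2) by (auto simp: \<theta>_def field_simps)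
    have "L t = sum h {..<a} + h j * (t + 1 - real a)"
      using H[of j] ab(1,2) by (simp add: L_def algebra_simps)
    also have "\<dots> = (1 - \<theta>) * sum h {..<a} + \<theta> * sum h {..<b}"
    proof -
      have "sum h {..<b} = sum h {..<a} + h j * (real b - real a)"
        using H[of b] ab(1,2) by simp
      then have "(1 - \<theta>) * sum h {..<a} + \<theta> * sum h {..<b} =
          sum h {..<a} + h j * (\<theta> * (real b - real a))"
        by (simp add: left_diff_distrib distrib_left)
      then show ?thesis
        unfolding \<theta>(3) by simp
    qed
    also have "\<dots> \<le> (1 - \<theta>) * g (real a - 1) + \<theta> * g (real b - 1)"
    proof (intro add_mono mult_left_mono)
      have g: "sum (nth w) {..<m} \<le> g (real m - 1)" if "m \<le> n" for m
        using \<open>g \<in> ?G\<close> that by (simp add: majorant)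
      show "sum h {..<a} \<le> g (real a - 1)" "sum h {..<b} \<le> g (real b - 1)"
        using g[of a] g[of b] ab by auto
    qed (use \<theta> in auto)
    also have "\<dots> \<le> g ((1 - \<theta>) *\<^sub>R (real a - 1) + \<theta> *\<^sub>R (real b - 1))"
      using concave_onD[of ?D g \<theta> "real a - 1" "real b - 1"] that ab \<theta> by auto
    also have "(1 - \<theta>) *\<^sub>R (real a - 1) + \<theta> *\<^sub>R (real b - 1) = t"
      using \<theta>(3) by (simp add: algebra_simps)
    finally show ?thesis .
  qed
  ultimately have "(INF g\<in>?G. g t) = L t"
    by (intro antisym cINF_lower2[of _ _ L] cINF_greatest) (auto intro!: bdd_belowI2)
  then show ?thesis
    by (simp add: least_concave_majorant_def L_def)
qed

lemma gren_eq:
  assumes h: "majorant_slopes (length w) (nth w) h"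
  shows "gren w = map h [0..<length w]"
proof -
  have "left_slope (least_concave_majorant {-1 .. real (length w) - 1} (cumsum_points w)) (real j)
      = h j" if "j < length w" for j
  proof -
    let ?f = "least_concave_majorant {-1 .. real (length w) - 1} (cumsum_points w)"
    have "\<forall>\<^sub>F t in at_left (real j). sum h {..<j} + h j * (t + 1 - real j) = ?f t"
      using eventually_at_left_real[of "real j - 1" "real j", simplified]
      by eventually_elim (auto intro!: least_concave_majorant_eq[symmetric] h that)
    moreover have "sum h {..<j} + h j * (real j + 1 - real j) = ?f (real j)"
      by (rule least_concave_majorant_eq[symmetric]) (use h that in auto)
    ultimately have "((\<lambda>t. sum h {..<j} + h j * (t + 1 - real j)) has_field_derivative h j)
        (at_left (real j)) = (?f has_field_derivative h j) (at_left (real j))"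
      by (rule has_field_derivative_cong_eventually)
    moreover have "((\<lambda>t. sum h {..<j} + h j * (t + 1 - real j)) has_field_derivative h j)
        (at_left (real j))"
      by (auto intro!: derivative_eq_intros)
    ultimately have "(?f has_field_derivative h j) (at_left (real j))"
      by simp
    then have "(?f has_vector_derivative h j) (at_left (real j))"
      by (simp only: has_real_derivative_iff_has_vector_derivative)
    then show ?thesis
      unfolding left_slope_def by (intro vector_derivative_within) auto
  qed
  then show ?thesis by (simp add: gren_def)
qed

lemma majorant_slopes_mono:
  assumes h: "majorant_slopes n w h" and h': "majorant_slopes n w' h'"
    and le: "\<And>i. i < n \<Longrightarrow> w i \<le> w' i" and "j < n"
  shows "h j \<le> h' j"
proof -
  obtain b where b: "j < b" "b \<le> n" "sum w {..<b} = sum h {..<b}"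
      "\<And>i. j \<le> i \<Longrightarrow> i < b \<Longrightarrow> h i = h j"
    using majorant_slopes_contact[OF h \<open>j < n\<close>] by (metis le_trans)
  obtain a where a: "a \<le> j" "sum w' {..<a} = sum h' {..<a}"
      "\<And>i. a \<le> i \<Longrightarrow> i \<le> j \<Longrightarrow> h' i = h' j"
    using majorant_slopes_contact[OF h' \<open>j < n\<close>] by (metis le_less_trans)
  obtain l where l: "b = a + l" "l > 0"
    using less_imp_add_positive[of a b] a(1) b(1) by auto
  have "real l * h j = (\<Sum>i<l. h j)" by simp
  also have "\<dots> \<le> (\<Sum>i<l. h (i + a))"
  proof (rule sum_mono)
    fix i assume i: "i \<in> {..<l}"
    show "h j \<le> h (i + a)"
    proof (cases "i + a \<le> j")
      case True
      then show ?thesis using majorant_slopesD(1)[OF h] \<open>j < n\<close> by blast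
    next
      case False
      then show ?thesis using b(4)[of "i + a"] i l by simp
    qed
  qed
  also have "\<dots> \<le> (\<Sum>i<l. w (i + a))"
    using b(2,3) majorant_slopesD(2)[OF h, of a] l by (simp add: sum_lessThan_add)
  also have "\<dots> \<le> (\<Sum>i<l. w' (i + a))"
    using le l b(2) by (intro sum_mono) auto
  also have "\<dots> \<le> (\<Sum>i<l. h' (i + a))"
    using a(2) majorant_slopesD(2)[OF h' b(2)] l by (simp add: sum_lessThan_add)
  also have "\<dots> \<le> (\<Sum>i<l. h' j)"
  proof (rule sum_mono)
    fix i assume i: "i \<in> {..<l}"
    show "h' (i + a) \<le> h' j"
    proof (cases "i + a \<le> j")
      case False
      then show ?thesis using majorant_slopesD(1)[OF h', of j "i + a"] i l b by simp
    qed (use a(3)[of "i + a"] in simp)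
  qed
  finally show ?thesis using l by simp
qed

lemma majorant_slopes_const: "majorant_slopes n (\<lambda>_. c) (\<lambda>_. c)"
  by (simp add: majorant_slopes_def)

lemma majorant_slopes_affine:
  assumes "majorant_slopes n w h" "c > 0"
  shows "majorant_slopes n (\<lambda>i. c * w i + d) (\<lambda>i. c * h i + d)"
  using assms by (auto simp: majorant_slopes_def sum.distrib simp flip: sum_distrib_left)

lemma majorant_slopes_cong_left:
  assumes "\<And>i. i < n \<Longrightarrow> w i = w' i" "majorant_slopes n w h"
  shows "majorant_slopes n w' h"
proof -
  have "sum w' {..<m} = sum w {..<m}" if "m \<le> n" for m
    using assms(1) that by (intro sum.cong) auto
  then show ?thesis using assms(2) by (auto simp: majorant_slopes_def)
qed

interpretation gren: isotone_operator gren
proof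
  show len: "length (gren w) = length w" for w
    by (simp add: gren_def)
  show "gren (u @ v) = gren u @ gren v" if le: "\<And>x y. x \<in> set u \<Longrightarrow> y \<in> set v \<Longrightarrow> y \<le> x" for u v
  proof -
    obtain f g where f: "majorant_slopes (length u) (nth u) f"
      and g: "majorant_slopes (length v) (nth v) g"
      using ex_majorant_slopes by metis
    have "g 0 \<le> f (length u - 1)" if "length u > 0" "length v > 0"
    proof -
      have "g 0 \<le> Max (set v)"
        by (rule majorant_slopes_mono[OF g majorant_slopes_const]) (use that in auto)
      also have "\<dots> \<le> f (length u - 1)"
        by (rule majorant_slopes_mono[OF majorant_slopes_const f]) (use that le in auto)
      finally show ?thesis .
    qed
    then have "majorant_slopes (length (u @ v)) (nth (u @ v))
        (\<lambda>i. if i < length u then f i else g (i - length u))"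
      using majorant_slopes_append[OF f g] by (simp add: nth_append[abs_def])
    then show ?thesis
      by (auto simp: gren_eq gren_eq[OF f] gren_eq[OF g] nth_append intro!: nth_equalityI)
  qed
  show "list_all2 (\<le>) (gren u) (gren v)" if uv: "list_all2 (\<le>) u v" for u v
  proof -
    obtain f g where f: "majorant_slopes (length u) (nth u) f"
      and g: "majorant_slopes (length v) (nth v) g"
      using ex_majorant_slopes by metis
    then show ?thesis
      using uv majorant_slopes_mono[of "length u" "nth u" f "nth v" g]
      by (auto simp: gren_eq[OF f] gren_eq[OF g] list_all2_conv_all_nth)
  qed
  show "gren (map (\<lambda>x. c * x + d) w) = map (\<lambda>x. c * x + d) (gren w)" if "c > 0" for c d w
  proof -
    obtain f where f: "majorant_slopes (length w) (nth w) f"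
      using ex_majorant_slopes by metis
    have "majorant_slopes (length w) (nth (map (\<lambda>x. c * x + d) w)) (\<lambda>i. c * f i + d)"
      by (rule majorant_slopes_cong_left[OF _ majorant_slopes_affine[OF f that]]) auto
    then show ?thesis
      using gren_eq[of "map (\<lambda>x. c * x + d) w" "\<lambda>i. c * f i + d"] by (simp add: gren_eq[OF f])
  qed
qed

context isotone_operator
begin

lemma F_nth_diff_le:
  assumes "length u = length v" "k < length v"
    and le: "\<And>i. i < length v \<Longrightarrow> \<bar>u ! i - v ! i\<bar> \<le> e"
  shows "\<bar>F u ! k - F v ! k\<bar> \<le> e"
proof -
  have shift: "F x ! k \<le> F y ! k + e"
    if "length x = length v" "length y = length v" "\<And>i. i < length v \<Longrightarrow> x ! i \<le> y ! i + e" for x y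
  proof -
    have "list_all2 (\<le>) (F x) (F (map (\<lambda>t. 1 * t + e) y))"
      by (rule F_mono) (use that in \<open>auto simp: list_all2_conv_all_nth\<close>)
    then show ?thesis
      unfolding F_affine[OF zero_less_one] using that assms(2)
      by (auto simp: list_all2_conv_all_nth)
  qed
  have "F u ! k \<le> F v ! k + e"
    by (rule shift) (use assms(1) le in \<open>auto simp: abs_le_iff algebra_simps\<close>)
  moreover have "F v ! k \<le> F u ! k + e"
    by (rule shift) (use assms(1) le in \<open>auto simp: abs_le_iff algebra_simps\<close>)
  ultimately show ?thesis by linarith
qed

lemma F_nth_segment:
  assumes "r \<le> x" "x \<le> s" "s < length w"
    and "\<And>i j. i < r \<Longrightarrow> r \<le> j \<Longrightarrow> j < length w \<Longrightarrow> w ! j \<le> w ! i"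
    and "\<And>i j. i \<le> s \<Longrightarrow> s < j \<Longrightarrow> j < length w \<Longrightarrow> w ! j \<le> w ! i"
  shows "F w ! x = F (map (nth w) [r..<Suc s]) ! (x - r)"
proof -
  define v where "v = map (nth w) [r..<Suc s]"
  have v: "v = drop r (take (Suc s) w)"
    using assms(1-3) by (auto simp: v_def simp del: upt_Suc intro!: nth_equalityI)
  have w: "w = take r w @ v @ drop (Suc s) w"
  proof -
    have "take r (take (Suc s) w) = take r w"
      using assms(1,2) by (simp add: min_def)
    then show ?thesis
      unfolding v by (metis append.assoc append_take_drop_id)
  qed
  have "F w = F (take r w) @ F (v @ drop (Suc s) w)"
  proof (subst w, rule F_append)
    fix a b assume "a \<in> set (take r w)" "b \<in> set (v @ drop (Suc s) w)"
    moreover from this have "b \<in> set (drop r w)"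
      using assms(1,2) set_drop_subset_set_drop[of r "Suc s" w] unfolding v drop_take
      by (auto dest: in_set_takeD)
    then obtain k where "k < length w - r" "b = w ! (r + k)"
      using assms(1-3) by (auto simp: in_set_conv_nth)
    moreover from calculation obtain i where "i < r" "a = w ! i"
      by (auto simp: in_set_conv_nth)
    ultimately obtain i j where "i < r" "a = w ! i" "r \<le> j" "j < length w" "b = w ! j"
      using that[of i "r + k"] by simp
    then show "b \<le> a" using assms(4) by simp
  qed
  also have "F (v @ drop (Suc s) w) = F v @ F (drop (Suc s) w)"
  proof (rule F_append)
    fix a b assume "a \<in> set v" "b \<in> set (drop (Suc s) w)"
    moreover from this obtain i where "i \<le> s" "a = w ! i"
      unfolding v_def by (auto simp del: upt_Suc simp: less_Suc_eq_le)
    moreover obtain k where "k < length w - Suc s" "b = w ! (Suc s + k)"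
      using \<open>b \<in> _\<close> assms(3) by (auto simp: in_set_conv_nth)
    ultimately obtain i j where "i \<le> s" "a = w ! i" "s < j" "j < length w" "b = w ! j"
      using that[of i "Suc s + k"] by simp
    then show "b \<le> a" using assms(5) by simp
  qed
  finally show ?thesis
    using assms(1-3) unfolding v_def[symmetric]
    by (auto simp: nth_append v)
qed

lemma continuous_on_F_nth:
  assumes "x \<in> {r..s}"
  shows "continuous_on UNIV (\<lambda>v. F (map v [r..<Suc s]) ! (x - r))"
proof (rule continuous_at_imp_continuous_on, rule ballI)
  fix v :: "nat \<Rightarrow> real"
  have *: "\<bar>F (map u [r..<Suc s]) ! (x - r) - F (map v [r..<Suc s]) ! (x - r)\<bar>
      \<le> (\<Sum>i\<in>{r..s}. \<bar>u i - v i\<bar>)" for u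
  proof (rule F_nth_diff_le)
    fix i assume "i < length (map v [r..<Suc s])"
    then have i: "r + i \<in> {r..s}" by (auto simp del: upt_Suc)
    then have "\<bar>u (r + i) - v (r + i)\<bar> \<le> (\<Sum>i\<in>{r..s}. \<bar>u i - v i\<bar>)"
      by (intro member_le_sum[of "r + i" _ "\<lambda>i. \<bar>u i - v i\<bar>"]) auto
    then show "\<bar>map u [r..<Suc s] ! i - map v [r..<Suc s] ! i\<bar> \<le> (\<Sum>i\<in>{r..s}. \<bar>u i - v i\<bar>)"
      using i by (simp del: upt_Suc)
  qed (use assms in auto)
  have coord: "((\<lambda>u. u i) \<longlongrightarrow> v i) (at v)" for i
  proof -
    have "continuous_on UNIV (\<lambda>u::nat \<Rightarrow> real. u i)"
      by (rule continuous_on_product_coordinates)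
    then show ?thesis by (simp add: continuous_on_def)
  qed
  have "((\<lambda>u. \<Sum>i\<in>{r..s}. \<bar>u i - v i\<bar>) \<longlongrightarrow> (\<Sum>i\<in>{r..s}. \<bar>v i - v i\<bar>)) (at v)"
    by (intro tendsto_intros coord)
  then have "((\<lambda>u. F (map u [r..<Suc s]) ! (x - r) - F (map v [r..<Suc s]) ! (x - r)) \<longlongrightarrow> 0) (at v)"
  proof (rule Lim_null_comparison[rotated, OF tendsto_eq_rhs])
    show "\<forall>\<^sub>F u in at v. norm (F (map u [r..<Suc s]) ! (x - r) - F (map v [r..<Suc s]) ! (x - r))
        \<le> (\<Sum>i\<in>{r..s}. \<bar>u i - v i\<bar>)"
      unfolding real_norm_def by (intro always_eventually allI *)
  qed simp
  then show "isCont (\<lambda>v. F (map v [r..<Suc s]) ! (x - r)) v"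
    unfolding isCont_def by (rule Lim_null[THEN iffD2])
qed

lemma continuous_map_on_segment:
  "continuous_map euclidean (product_topology (\<lambda>_. euclideanreal) {r..s}) (on_segment F r s)"
  unfolding continuous_map_componentwise
proof (intro conjI ballI)
  fix x assume "x \<in> {r..s}"
  then show "continuous_map euclidean euclideanreal (\<lambda>v. on_segment F r s v x)"
    using continuous_on_F_nth[of x r s] by (simp add: on_segment_def del: upt_Suc)
qed (auto simp: on_segment_def)

lemma on_segment_affine:
  assumes "c > 0"
  shows "on_segment F r s (\<lambda>x. c * v x + d) = (\<lambda>x\<in>{r..s}. c * on_segment F r s v x + d)"
proof -
  have "map (\<lambda>x. c * v x + d) [r..<Suc s] = map (\<lambda>t. c * t + d) (map v [r..<Suc s])"
    by simp
  then show ?thesis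
    unfolding on_segment_def F_affine[OF assms, symmetric]
    by (auto simp: fun_eq_iff F_affine[OF assms] simp del: upt_Suc map_map)
qed

end

context
  fixes p :: "nat pmf" and r s :: nat and X :: "nat \<Rightarrow> 'a \<Rightarrow> nat" and n :: nat and \<omega> :: 'a and \<epsilon> :: real
  assumes antimono: "\<And>x. pmf p (x + 1) \<le> pmf p x"
    and rs: "r \<le> s"
    and left: "r > 0 \<Longrightarrow> pmf p r + 2 * \<epsilon> \<le> pmf p (r - 1)"
    and const: "\<And>x. x \<in> {r..s} \<Longrightarrow> pmf p x = pmf p r"
    and right: "pmf p (s + 1) + 2 * \<epsilon> \<le> pmf p s"
    and n: "n > 0"
    and close: "\<And>x. \<bar>empirical X n \<omega> x - pmf p x\<bar> < \<epsilon>"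
begin

lemma nth_default_eq_on_segment:
  assumes "isotone_operator F" and x: "x \<in> {r..s}"
  shows "nth_default 0 (F (empirical_vector X n \<omega>)) x = on_segment F r s (empirical X n \<omega>) x"
proof -
  interpret isotone_operator F by fact
  let ?q = "empirical X n \<omega>" and ?w = "empirical_vector X n \<omega>"
  define m where "m = (MAX i\<in>{1..n}. X i \<omega>)"
  have w: "?w = map ?q [0..<Suc m]"
    by (simp add: empirical_vector_def m_def)
  have len: "length ?w = Suc m" by (simp add: w)
  have nth_w: "?w ! i = ?q i" if "i < Suc m" for i
    using that by (simp add: w del: upt_Suc)
  have p_mono: "pmf p j \<le> pmf p i" if "i \<le> j" for i j
    using that antimono by (simp add: lift_Suc_antimono_le)
  have q: "?q i < pmf p i + \<epsilon>" "pmf p i - \<epsilon> < ?q i" for i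
    using close[of i] by (auto simp: abs_if split: if_splits)
  have "s \<le> m"
  proof (rule ccontr)
    assume "\<not> s \<le> m"
    then have "{i \<in> {1..n}. X i \<omega> = s} = {}"
      using Max_ge[of "(\<lambda>i. X i \<omega>) ` {1..n}"] by (fastforce simp: m_def)
    then have "?q s = 0" unfolding empirical_def by simp
    moreover have "0 < ?q s"
      using q(2)[of s] q[of "s + 1"] right pmf_nonneg[of p "s + 1"] by linarith
    ultimately show False by simp
  qed
  have "F ?w ! x = F (map (nth ?w) [r..<Suc s]) ! (x - r)"
  proof (rule F_nth_segment)
    fix i j assume ij: "i < r" "r \<le> j" "j < length ?w"
    then have "pmf p (r - 1) \<le> pmf p i" "pmf p j \<le> pmf p r"
      by (auto intro: p_mono)
    then show "?w ! j \<le> ?w ! i"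
      using ij q(1)[of j] q(2)[of i] left by (simp add: nth_w len)
  next
    fix i j assume ij: "i \<le> s" "s < j" "j < length ?w"
    then have "pmf p s \<le> pmf p i" "pmf p j \<le> pmf p (s + 1)"
      by (auto intro!: p_mono)
    then show "?w ! j \<le> ?w ! i"
      using ij q(1)[of j] q(2)[of i] right by (simp add: nth_w len)
  qed (use x \<open>s \<le> m\<close> len in auto)
  also have "map (nth ?w) [r..<Suc s] = map ?q [r..<Suc s]"
    using \<open>s \<le> m\<close> by (auto simp: nth_w simp del: upt_Suc)
  finally show ?thesis
    using x \<open>s \<le> m\<close> len by (simp add: nth_default_def on_segment_def del: upt_Suc)
qed

lemma segment_fluctuation_eq:
  assumes "isotone_operator F"
  shows "segment r s (fluctuation (\<lambda>n \<omega>. nth_default 0 (F (empirical_vector X n \<omega>))) p n \<omega>)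
    = on_segment F r s (fluctuation (empirical X) p n \<omega>)"
proof -
  interpret isotone_operator F by fact
  have "on_segment F r s (fluctuation (empirical X) p n \<omega>) =
     on_segment F r s (\<lambda>x. sqrt n * empirical X n \<omega> x + (- sqrt n * pmf p r))"
  proof -
    have "map (fluctuation (empirical X) p n \<omega>) [r..<Suc s]
        = map (\<lambda>x. sqrt n * empirical X n \<omega> x + (- sqrt n * pmf p r)) [r..<Suc s]"
    proof (rule map_cong[OF refl])
      fix x assume "x \<in> set [r..<Suc s]"
      then have "pmf p x = pmf p r" by (intro const) auto
      then show "fluctuation (empirical X) p n \<omega> x
          = sqrt n * empirical X n \<omega> x + (- sqrt n * pmf p r)"
        by (simp add: fluctuation_def right_diff_distrib)
    qed
    then show ?thesis unfolding on_segment_def by (simp only:)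
  qed
  also have "\<dots> = (\<lambda>x\<in>{r..s}. sqrt n * on_segment F r s (empirical X n \<omega>) x + (- sqrt n * pmf p r))"
    by (rule on_segment_affine) (use n in simp)
  also have "\<dots> = segment r s (fluctuation (\<lambda>n \<omega>. nth_default 0 (F (empirical_vector X n \<omega>))) p n \<omega>)"
    unfolding segment_def
  proof (rule restrict_ext)
    fix x assume x: "x \<in> {r..s}"
    show "sqrt n * on_segment F r s (empirical X n \<omega>) x + (- sqrt n * pmf p r)
        = fluctuation (\<lambda>n \<omega>. nth_default 0 (F (empirical_vector X n \<omega>))) p n \<omega> x"
      unfolding fluctuation_def nth_default_eq_on_segment[OF assms x] const[OF x]
      by (simp add: algebra_simps)
  qed
  finally show ?thesis by simp
qed

end

subsection \<open>The Cramer-Wold device\<close>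

inductive_set trig_poly :: "'i set \<Rightarrow> (('i \<Rightarrow> real) \<Rightarrow> real) set" for J where
  cos: "(\<lambda>x. c * cos (b + (\<Sum>i\<in>J. a i * x i))) \<in> trig_poly J"
| add: "f \<in> trig_poly J \<Longrightarrow> g \<in> trig_poly J \<Longrightarrow> (\<lambda>x. f x + g x) \<in> trig_poly J"

lemma trig_poly_mult_cos:
  assumes "g \<in> trig_poly J"
  shows "(\<lambda>x. c * cos (b + (\<Sum>i\<in>J. a i * x i)) * g x) \<in> trig_poly J"
  using assms
proof induction
  case (cos c' b' a')
  have "(\<lambda>x. c * cos (b + (\<Sum>i\<in>J. a i * x i)) * (c' * cos (b' + (\<Sum>i\<in>J. a' i * x i))))
    = (\<lambda>x. c * c' / 2 * cos ((b - b') + (\<Sum>i\<in>J. (a i - a' i) * x i))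
         + c * c' / 2 * cos ((b + b') + (\<Sum>i\<in>J. (a i + a' i) * x i)))"
  proof
    fix x :: "'a \<Rightarrow> real"
    define u v where "u = b + (\<Sum>i\<in>J. a i * x i)" and "v = b' + (\<Sum>i\<in>J. a' i * x i)"
    have uv: "(b - b') + (\<Sum>i\<in>J. (a i - a' i) * x i) = u - v"
      "(b + b') + (\<Sum>i\<in>J. (a i + a' i) * x i) = u + v"
      by (simp_all add: u_def v_def sum.distrib sum_subtractf algebra_simps)
    show "c * cos (b + (\<Sum>i\<in>J. a i * x i)) * (c' * cos (b' + (\<Sum>i\<in>J. a' i * x i)))
       = c * c' / 2 * cos ((b - b') + (\<Sum>i\<in>J. (a i - a' i) * x i))
         + c * c' / 2 * cos ((b + b') + (\<Sum>i\<in>J. (a i + a' i) * x i))"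
      unfolding uv unfolding u_def[symmetric] v_def[symmetric] cos_add cos_diff
      by (simp add: algebra_simps)
  qed
  then show ?case
    by (simp only: trig_poly.intros)
next
  case (add f g)
  show ?case
    unfolding distrib_left by (rule trig_poly.add[OF add.IH])
qed

lemma trig_poly_mult:
  assumes "f \<in> trig_poly J" "g \<in> trig_poly J"
  shows "(\<lambda>x. f x * g x) \<in> trig_poly J"
  using assms
proof (induction rule: trig_poly.induct)
  case (cos c b a)
  then show ?case by (rule trig_poly_mult_cos)
next
  case (add f h)
  then show ?case
    unfolding distrib_right by (intro trig_poly.add) auto
qed

lemma trig_poly_const: "(\<lambda>_. c) \<in> trig_poly J"
  using trig_poly.cos[of c 0 "\<lambda>_. 0" J] by simp

lemma trig_poly_cos_coordinate:
  assumes "finite J" "i \<in> J"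
  shows "(\<lambda>x. cos (b + x i / T)) \<in> trig_poly J"
proof -
  have "(\<Sum>j\<in>J. (if j = i then 1 / T else 0) * x j) = x i / T" for x :: "'a \<Rightarrow> real"
    using assms by (subst sum.remove[of _ i]) (auto intro!: sum.neutral)
  then show ?thesis
    using trig_poly.cos[of 1 b "\<lambda>j. if j = i then 1 / T else 0" J] by simp
qed

lemma trig_poly_measurable:
  fixes J :: "'i::countable set"
  assumes "f \<in> trig_poly J"
  shows "f \<in> borel_measurable borel"
  using assms
proof induction
  case (cos c b a)
  have [measurable]: "(\<lambda>x::'i \<Rightarrow> real. x i) \<in> borel_measurable borel" for i
    by (intro borel_measurable_continuous_onI continuous_on_product_coordinates)
  show ?case by measurable
qed auto

lemma trig_poly_bounded:
  assumes "f \<in> trig_poly J"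
  obtains B where "\<And>x. \<bar>f x\<bar> \<le> B"
proof -
  have "\<exists>B. \<forall>x. \<bar>f x\<bar> \<le> B"
    using assms
  proof induction
    case (cos c b a)
    show ?case
      by (intro exI[of _ "\<bar>c\<bar>"] allI) (auto simp: abs_mult intro: mult_left_le)
  next
    case (add f g)
    then obtain B B' where "\<forall>x. \<bar>f x\<bar> \<le> B" "\<forall>x. \<bar>g x\<bar> \<le> B'" by blast
    then have "\<bar>f x + g x\<bar> \<le> B + B'" for x
      by (meson abs_triangle_ineq add_mono order_trans)
    then show ?case by blast
  qed
  then show ?thesis using that by blast
qed

text \<open>
  Sampling \<open>f\<close> at \<open>T arcsin (sin (x\<^sub>i / T))\<close> turns it into a continuous function on the torus
  that agrees with \<open>f\<close> on the box of side \<open>\<pi> T\<close> and keeps the bound of \<open>f\<close> everywhere.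
\<close>

lemma trig_poly_approximation:
  fixes f :: "('i::countable \<Rightarrow> real) \<Rightarrow> real"
  assumes "finite J" "T > 0" "e > 0" and f: "continuous_on UNIV f"
  obtains g where "g \<in> trig_poly J"
    "\<And>x. \<bar>f (\<lambda>i. if i \<in> J then T * arcsin (sin (x i / T)) else 0) - g x\<bar> < e"
proof -
  define S where "S = (\<Pi>\<^sub>E i\<in>(UNIV :: 'i set). if i \<in> J then sphere 0 1 else {1 :: complex})"
  define E where "E x i = (if i \<in> J then cis (x i / T) else 1)" for x :: "'i \<Rightarrow> real" and i
  define R where "R = {q. continuous_on S q \<and> (\<lambda>x. q (E x)) \<in> trig_poly J}"
  define F where "F z = f (\<lambda>i. if i \<in> J then T * arcsin (Im (z i)) else 0)" for z :: "'i \<Rightarrow> complex"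
  have ES: "E x \<in> S" for x by (auto simp: E_def S_def)
  have coord: "continuous_on S (\<lambda>z. z i)" for i
    by (rule continuous_on_subset[OF continuous_on_product_coordinates]) auto
  interpret function_ring_on R S
  proof
    have "compactin (product_topology (\<lambda>_. euclidean) UNIV) S"
      unfolding S_def by (subst compactin_PiE) auto
    then show "compact S"
      by (simp add: euclidean_product_topology)
    show "\<exists>f\<in>R. f x \<noteq> f y" if xy: "x \<in> S" "y \<in> S" "x \<noteq> y" for x y
    proof -
      obtain i where i: "x i \<noteq> y i" using xy(3) by blast
      moreover have "z i = 1" if "z \<in> S" "i \<notin> J" for z
        using PiE_mem[OF that(1)[unfolded S_def], of i] that(2) by simp
      ultimately have "i \<in> J" using xy(1,2) by metis
      have "(\<lambda>x. Re (E x i)) \<in> trig_poly J"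
        using trig_poly_cos_coordinate[OF \<open>finite J\<close> \<open>i \<in> J\<close>, of 0 T] \<open>i \<in> J\<close>
        by (simp add: E_def)
      moreover have "(\<lambda>x. Im (E x i)) \<in> trig_poly J"
        using trig_poly_cos_coordinate[OF \<open>finite J\<close> \<open>i \<in> J\<close>, of "- pi / 2" T] \<open>i \<in> J\<close>
        by (simp add: E_def cos_diff)
      ultimately have "(\<lambda>z. Re (z i)) \<in> R" "(\<lambda>z. Im (z i)) \<in> R"
        unfolding R_def using coord by (simp_all add: continuous_on_Re continuous_on_Im)
      moreover have "Re (x i) \<noteq> Re (y i) \<or> Im (x i) \<noteq> Im (y i)"
        using i complex_eq_iff[of "x i" "y i"] by simp
      ultimately show ?thesis
        by (elim disjE) (rule bexI[of _ "\<lambda>z. Re (z i)"] bexI[of _ "\<lambda>z. Im (z i)"]; assumption)+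
    qed
  qed (auto simp: R_def intro: continuous_on_add continuous_on_mult trig_poly.add trig_poly_mult
        trig_poly_const)
  have "continuous_on S F"
    unfolding F_def
  proof (rule continuous_on_compose2[OF f])
    show "continuous_on S (\<lambda>z i. if i \<in> J then T * arcsin (Im (z i)) else 0)"
    proof (rule continuous_on_coordinatewise_then_product)
      fix i
      have "\<bar>Im (z i)\<bar> \<le> 1" if "z \<in> S" "i \<in> J" for z
        using that abs_Im_le_cmod[of "z i"] by (auto simp: S_def PiE_iff split: if_splits)
      then show "continuous_on S (\<lambda>z. if i \<in> J then T * arcsin (Im (z i)) else 0)"
        by (cases "i \<in> J") (auto intro!: continuous_intros coord simp: abs_le_iff)
    qed
  qed auto
  then obtain q where q: "q \<in> R" "\<And>z. z \<in> S \<Longrightarrow> \<bar>F z - q z\<bar> < e"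
    using Stone_Weierstrass_basic \<open>e > 0\<close> by blast
  have "F (E x) = f (\<lambda>i. if i \<in> J then T * arcsin (sin (x i / T)) else 0)" for x
    unfolding F_def by (rule arg_cong[of _ _ f]) (auto simp: E_def)
  then show ?thesis
    using that[of "\<lambda>x. q (E x)"] q ES by (auto simp: R_def) metis
qed

lemma (in prob_space) trig_poly_approximation_expectation:
  fixes f g :: "('i::countable \<Rightarrow> real) \<Rightarrow> real" and W :: "'a \<Rightarrow> 'i \<Rightarrow> real"
  assumes "L > 0" and W: "\<And>i. (\<lambda>\<omega>. W \<omega> i) \<in> borel_measurable M"
    and moment: "\<And>i. i \<in> J \<Longrightarrow> integrable M (\<lambda>\<omega>. (W \<omega> i)\<^sup>2)"
      "\<And>i. i \<in> J \<Longrightarrow> expectation (\<lambda>\<omega>. (W \<omega> i)\<^sup>2) \<le> C"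
    and f: "continuous_on UNIV f" "\<And>x. \<bar>f x\<bar> \<le> B" "\<And>x y. (\<And>i. i \<in> J \<Longrightarrow> x i = y i) \<Longrightarrow> f x = f y"
    and "finite J"
    and g: "g \<in> trig_poly J"
    and fg: "\<And>x. \<bar>f (\<lambda>i. if i \<in> J then (2 * L / pi) * arcsin (sin (x i / (2 * L / pi))) else 0) - g x\<bar> < e"
  shows "\<bar>expectation (\<lambda>\<omega>. f (W \<omega>)) - expectation (\<lambda>\<omega>. g (W \<omega>))\<bar>
    \<le> e + 2 * B * card J * C / L\<^sup>2"
proof -
  have B: "0 \<le> B" using f(2)[of undefined] by linarith
  have Wb [measurable]: "W \<in> borel_measurable M"
    by (rule measurable_coordinatewise_then_product) (rule W)
  note [measurable] = trig_poly_measurable[OF g] borel_measurable_continuous_onI[OF f(1)]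
  obtain Bg where Bg: "\<And>x. \<bar>g x\<bar> \<le> Bg" using trig_poly_bounded[OF g] by blast
  have int: "integrable M (\<lambda>\<omega>. f (W \<omega>))" "integrable M (\<lambda>\<omega>. g (W \<omega>))"
    by (rule integrable_const_bound[where B = B]; use f(2) in simp)
       (rule integrable_const_bound[where B = Bg]; use Bg in simp)
  have pw: "\<bar>f x - g x\<bar> \<le> e + 2 * B / L\<^sup>2 * (\<Sum>i\<in>J. (x i)\<^sup>2)" for x
  proof -
    define T where "T = 2 * L / pi"
    define y where "y = (\<lambda>i. if i \<in> J then T * arcsin (sin (x i / T)) else 0)"
    have T: "T > 0" "pi / 2 * T = L" using \<open>L > 0\<close> by (auto simp: T_def)
    have "\<bar>f x - f y\<bar> \<le> 2 * B / L\<^sup>2 * (\<Sum>i\<in>J. (x i)\<^sup>2)"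
    proof (cases "\<forall>i\<in>J. \<bar>x i\<bar> \<le> L")
      case True
      have "x i = y i" if "i \<in> J" for i
      proof -
        have "\<bar>x i / T\<bar> \<le> pi / 2"
          using True that T by (simp add: field_simps)
        then have "arcsin (sin (x i / T)) = x i / T"
          by (intro arcsin_sin; linarith)
        then show ?thesis using that T(1) by (simp add: y_def)
      qed
      then have "f x = f y" by (rule f(3))
      then show ?thesis using B by (simp add: sum_nonneg)
    next
      case False
      then obtain j where j: "j \<in> J" "L < \<bar>x j\<bar>" by auto
      have "L\<^sup>2 \<le> (x j)\<^sup>2"
        using j \<open>L > 0\<close> abs_le_square_iff[of L "x j"] by simp
      also have "\<dots> \<le> (\<Sum>i\<in>J. (x i)\<^sup>2)"
        using j \<open>finite J\<close> by (intro member_le_sum[of j J "\<lambda>i. (x i)\<^sup>2"]) auto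
      finally have "1 \<le> (\<Sum>i\<in>J. (x i)\<^sup>2) / L\<^sup>2"
        using \<open>L > 0\<close> by (simp add: field_simps)
      then have "2 * B * 1 \<le> 2 * B * ((\<Sum>i\<in>J. (x i)\<^sup>2) / L\<^sup>2)"
        using B by (intro mult_left_mono) auto
      then show ?thesis using f(2)[of x] f(2)[of y] by (auto simp: abs_le_iff)
    qed
    moreover have "\<bar>f y - g x\<bar> < e"
      using fg[of x] unfolding y_def T_def .
    ultimately show ?thesis by linarith
  qed
  have int_sq: "integrable M (\<lambda>\<omega>. \<Sum>i\<in>J. (W \<omega> i)\<^sup>2)"
    using moment(1) by simp
  have "\<bar>expectation (\<lambda>\<omega>. f (W \<omega>)) - expectation (\<lambda>\<omega>. g (W \<omega>))\<bar>
      = \<bar>expectation (\<lambda>\<omega>. f (W \<omega>) - g (W \<omega>))\<bar>"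
    using int by simp
  also have "\<dots> \<le> expectation (\<lambda>\<omega>. \<bar>f (W \<omega>) - g (W \<omega>)\<bar>)"
    by (rule integral_abs_bound)
  also have "\<dots> \<le> expectation (\<lambda>\<omega>. e + 2 * B / L\<^sup>2 * (\<Sum>i\<in>J. (W \<omega> i)\<^sup>2))"
    using int int_sq pw by (intro integral_mono) auto
  also have "\<dots> = e + 2 * B / L\<^sup>2 * (\<Sum>i\<in>J. expectation (\<lambda>\<omega>. (W \<omega> i)\<^sup>2))"
    using int_sq moment(1) by (simp add: prob_space)
  also have "\<dots> \<le> e + 2 * B / L\<^sup>2 * (\<Sum>i\<in>J. C)"
    using B moment(2) by (intro add_left_mono mult_left_mono sum_mono) auto
  finally show ?thesis by (simp add: mult_ac)
qed

lemma Cramer_Wold: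
  fixes Z :: "nat \<Rightarrow> 'a \<Rightarrow> 'i::countable \<Rightarrow> real" and Z' :: "'b \<Rightarrow> 'i \<Rightarrow> real"
    and f :: "('i \<Rightarrow> real) \<Rightarrow> real"
  assumes "prob_space M" "prob_space N" "finite J"
    and Z: "\<And>n i. (\<lambda>\<omega>. Z n \<omega> i) \<in> borel_measurable M"
      "\<And>n i. i \<in> J \<Longrightarrow> integrable M (\<lambda>\<omega>. (Z n \<omega> i)\<^sup>2)"
      "\<And>n i. i \<in> J \<Longrightarrow> (\<integral>\<omega>. (Z n \<omega> i)\<^sup>2 \<partial>M) \<le> C"
    and Z': "\<And>i. (\<lambda>\<omega>. Z' \<omega> i) \<in> borel_measurable N"
      "\<And>i. i \<in> J \<Longrightarrow> integrable N (\<lambda>\<omega>. (Z' \<omega> i)\<^sup>2)"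
      "\<And>i. i \<in> J \<Longrightarrow> (\<integral>\<omega>. (Z' \<omega> i)\<^sup>2 \<partial>N) \<le> C"
    and cos: "\<And>a b. (\<lambda>n. \<integral>\<omega>. cos (b + (\<Sum>i\<in>J. a i * Z n \<omega> i)) \<partial>M)
      \<longlonglongrightarrow> (\<integral>\<omega>. cos (b + (\<Sum>i\<in>J. a i * Z' \<omega> i)) \<partial>N)"
    and f: "continuous_on UNIV f" "\<And>x. \<bar>f x\<bar> \<le> B" "\<And>x y. (\<And>i. i \<in> J \<Longrightarrow> x i = y i) \<Longrightarrow> f x = f y"
  shows "(\<lambda>n. \<integral>\<omega>. f (Z n \<omega>) \<partial>M) \<longlonglongrightarrow> (\<integral>\<omega>. f (Z' \<omega>) \<partial>N)"
proof (rule LIMSEQ_I)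
  interpret M: prob_space M by fact
  interpret N: prob_space N by fact
  have Zb [measurable]: "Z n \<in> borel_measurable M" for n
    by (rule measurable_coordinatewise_then_product) (rule Z)
  have Zb' [measurable]: "Z' \<in> borel_measurable N"
    by (rule measurable_coordinatewise_then_product) (rule Z')
  have conv: "(\<lambda>n. \<integral>\<omega>. g (Z n \<omega>) \<partial>M) \<longlonglongrightarrow> (\<integral>\<omega>. g (Z' \<omega>) \<partial>N)" if "g \<in> trig_poly J" for g
    using that
  proof induction
    case (cos c b a)
    then show ?case
      using tendsto_mult_left[OF assms(10), of c b a] by simp
  next
    case (add g h)
    note [measurable] = trig_poly_measurable[OF add.hyps(1)] trig_poly_measurable[OF add.hyps(2)]
    obtain Bg Bh where Bg: "\<And>x. \<bar>g x\<bar> \<le> Bg" and Bh: "\<And>x. \<bar>h x\<bar> \<le> Bh"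
      using trig_poly_bounded add.hyps by metis
    have "integrable M (\<lambda>\<omega>. g (Z n \<omega>))" "integrable N (\<lambda>\<omega>. g (Z' \<omega>))" for n
      using Bg by (auto intro!: M.integrable_const_bound[where B = Bg]
          N.integrable_const_bound[where B = Bg])
    moreover have "integrable M (\<lambda>\<omega>. h (Z n \<omega>))" "integrable N (\<lambda>\<omega>. h (Z' \<omega>))" for n
      using Bh by (auto intro!: M.integrable_const_bound[where B = Bh]
          N.integrable_const_bound[where B = Bh])
    ultimately
    show ?case using add.IH by (simp add: tendsto_add)
  qed
  fix \<delta> :: real assume "\<delta> > 0"
  have "((\<lambda>L. 2 * B * card J * C / L\<^sup>2) \<longlongrightarrow> 0) at_top"
    by (intro tendsto_divide_0[OF tendsto_const] filterlim_at_top_imp_at_infinity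
        filterlim_pow_at_top filterlim_ident) simp
  then have "\<forall>\<^sub>F L in at_top. 2 * B * card J * C / L\<^sup>2 < \<delta> / 6"
    using \<open>\<delta> > 0\<close> by (intro order_tendstoD) auto
  then obtain L where L: "L > 0" "2 * B * card J * C / L\<^sup>2 < \<delta> / 6"
    using eventually_conj[OF eventually_gt_at_top[of 0]] eventually_happens
    by (metis (mono_tags, lifting) trivial_limit_at_top_linorder)
  obtain g where g: "g \<in> trig_poly J"
    "\<And>x. \<bar>f (\<lambda>i. if i \<in> J then (2 * L / pi) * arcsin (sin (x i / (2 * L / pi))) else 0) - g x\<bar> < \<delta> / 6"
    by (rule trig_poly_approximation[of J "2 * L / pi" "\<delta> / 6" f]) (use L(1) f(1) \<open>\<delta> > 0\<close> \<open>finite J\<close> in auto)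
  have 1: "\<bar>(\<integral>\<omega>. f (Z n \<omega>) \<partial>M) - (\<integral>\<omega>. g (Z n \<omega>) \<partial>M)\<bar> < \<delta> / 3" for n
    using M.trig_poly_approximation_expectation[where W = "Z n", OF L(1) Z f \<open>finite J\<close> g] L(2) by simp
  have 2: "\<bar>(\<integral>\<omega>. f (Z' \<omega>) \<partial>N) - (\<integral>\<omega>. g (Z' \<omega>) \<partial>N)\<bar> < \<delta> / 3"
    using N.trig_poly_approximation_expectation[where W = Z', OF L(1) Z' f \<open>finite J\<close> g] L(2) by simp
  obtain n0 where n0: "\<And>n. n \<ge> n0 \<Longrightarrow> norm ((\<integral>\<omega>. g (Z n \<omega>) \<partial>M) - (\<integral>\<omega>. g (Z' \<omega>) \<partial>N)) < \<delta> / 3"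
    using LIMSEQ_D[OF conv[OF g(1)], of "\<delta> / 3"] \<open>\<delta> > 0\<close> by auto
  have "norm ((\<integral>\<omega>. f (Z n \<omega>) \<partial>M) - (\<integral>\<omega>. f (Z' \<omega>) \<partial>N)) < \<delta>" if "n \<ge> n0" for n
    using 1[of n] 2 n0[OF that] unfolding real_norm_def by linarith
  then show "\<exists>n0. \<forall>n\<ge>n0. norm ((\<integral>\<omega>. f (Z n \<omega>) \<partial>M) - (\<integral>\<omega>. f (Z' \<omega>) \<partial>N)) < \<delta>"
    by blast
qed

subsection \<open>Moments and central limit theorem for the empirical frequencies\<close>

definition projection_score :: "nat pmf \<Rightarrow> nat set \<Rightarrow> (nat \<Rightarrow> real) \<Rightarrow> nat \<Rightarrow> real" where
  "projection_score p J a y = (\<Sum>x\<in>J. a x * (indicator {x} y - pmf p x))"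

lemma integrable_pmf_bounded:
  fixes g :: "'b \<Rightarrow> real"
  shows "(\<And>y. \<bar>g y\<bar> \<le> B) \<Longrightarrow> integrable (measure_pmf p) g"
  by (rule measure_pmf.integrable_const_bound[where B = B]) auto

lemma integrable_indicator_pmf [simp]:
  "integrable (measure_pmf p) (\<lambda>y. indicator A y :: real)"
  by (rule integrable_pmf_bounded[where B = 1]) (auto simp: indicator_def)

lemma pmf_centred_indicator_product:
  "integrable (measure_pmf p) (\<lambda>y. (indicator {x} y - pmf p x) * (indicator {x'} y - pmf p x'))"
  "(\<integral>y. (indicator {x} y - pmf p x) * (indicator {x'} y - pmf p x') \<partial>measure_pmf p)
    = pmf p x * (if x = x' then 1 else 0) - pmf p x * pmf p x'"
proof -
  have eq: "(\<lambda>y. (indicator {x} y - pmf p x) * (indicator {x'} y - pmf p x')) =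
      (\<lambda>y. (if x = x' then 1 else 0) * indicator {x} y - pmf p x' * indicator {x} y
         - pmf p x * indicator {x'} y + pmf p x * pmf p x')"
    by (auto simp: fun_eq_iff indicator_def algebra_simps)
  show "integrable (measure_pmf p) (\<lambda>y. (indicator {x} y - pmf p x) * (indicator {x'} y - pmf p x'))"
    unfolding eq by simp
  show "(\<integral>y. (indicator {x} y - pmf p x) * (indicator {x'} y - pmf p x') \<partial>measure_pmf p)
    = pmf p x * (if x = x' then 1 else 0) - pmf p x * pmf p x'"
    unfolding eq by (simp add: measure_pmf_single algebra_simps)
qed

lemma projection_score_square:
  "(projection_score p J a y)\<^sup>2 =
    (\<Sum>x\<in>J. \<Sum>x'\<in>J. a x * a x' * ((indicator {x} y - pmf p x) * (indicator {x'} y - pmf p x')))"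
  unfolding projection_score_def power2_eq_square sum_product by (simp add: mult_ac)

lemma projection_score_mean: "(\<integral>y. projection_score p J a y \<partial>measure_pmf p) = 0"
  unfolding projection_score_def by (simp add: measure_pmf_single)

lemma projection_score_variance:
  "(\<integral>y. (projection_score p J a y)\<^sup>2 \<partial>measure_pmf p) =
    (\<Sum>x\<in>J. \<Sum>x'\<in>J. a x * a x' * (pmf p x * (if x = x' then 1 else 0) - pmf p x * pmf p x'))"
  unfolding projection_score_square by (simp add: pmf_centred_indicator_product)

lemma projection_score_bounded: "\<bar>projection_score p J a y\<bar> \<le> (\<Sum>x\<in>J. \<bar>a x\<bar>)"
proof -
  have "\<bar>a x * (indicator {x} y - pmf p x)\<bar> \<le> \<bar>a x\<bar>" for x
    using pmf_le_1[of p x] pmf_nonneg[of p x]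
    by (auto simp: abs_mult indicator_def intro!: mult_left_le)
  then show ?thesis
    unfolding projection_score_def by (intro order_trans[OF sum_abs] sum_mono)
qed

lemma (in prob_space) indep_vars_reindex:
  assumes f: "inj_on f I" and indep: "indep_vars M' X (f ` I)"
  shows "indep_vars (\<lambda>i. M' (f i)) (\<lambda>i. X (f i)) I"
  unfolding indep_vars_def2 indep_sets_def
proof (intro conjI ballI allI impI)
  let ?F = "\<lambda>i. {X i -` A \<inter> space M |A. A \<in> sets (M' i)}"
  show "random_variable (M' (f i)) (X (f i))" if "i \<in> I" for i
    using indep that by (simp add: indep_vars_def2)
  show "?F (f i) \<subseteq> events" if "i \<in> I" for i
    using indep that by (auto simp: indep_vars_def2)
  fix J A assume J: "J \<subseteq> I" "J \<noteq> {}" "finite J" and A: "A \<in> (\<Pi> i\<in>J. ?F (f i))"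
  define B where "B = (\<lambda>j. A (inv_into J f j))"
  have inj: "inj_on f J" using f J(1) by (rule inj_on_subset)
  have B: "B (f j) = A j" if "j \<in> J" for j
    using that inj by (simp add: B_def)
  have "B \<in> (\<Pi> i\<in>f ` J. ?F i)"
    using A B by (auto simp: Pi_iff)
  then have "prob (\<Inter>j\<in>f ` J. B j) = (\<Prod>j\<in>f ` J. prob (B j))"
    using indep J unfolding indep_vars_def2 indep_sets_def by (meson finite_imageI image_is_empty image_mono)
  then show "prob (\<Inter>j\<in>J. A j) = (\<Prod>j\<in>J. prob (A j))"
    using B by (simp add: prod.reindex[OF inj])
qed

locale iid_sample = prob_space +
  fixes X :: "nat \<Rightarrow> 'a \<Rightarrow> nat" and p :: "nat pmf"
  assumes indep_X: "indep_vars (\<lambda>_. count_space UNIV) X {1..}"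
    and distr_X: "i \<ge> 1 \<Longrightarrow> distr M (count_space UNIV) (X i) = measure_pmf p"
begin

lemma X_measurable: "i \<ge> 1 \<Longrightarrow> X i \<in> M \<rightarrow>\<^sub>M count_space UNIV"
  using indep_X by (auto simp: indep_vars_def)

lemma comp_X_measurable:
  fixes g :: "nat \<Rightarrow> real"
  shows "i \<ge> 1 \<Longrightarrow> (\<lambda>\<omega>. g (X i \<omega>)) \<in> borel_measurable M"
  using measurable_compose[OF X_measurable, of i g borel] by auto

lemma sum_comp_X_measurable:
  fixes g :: "nat \<Rightarrow> real"
  shows "(\<lambda>\<omega>. \<Sum>i\<in>{1..n}. g (X i \<omega>)) \<in> borel_measurable M"
  by (intro borel_measurable_sum comp_X_measurable) auto

lemma expectation_comp_X:
  fixes g :: "nat \<Rightarrow> real"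
  assumes "i \<ge> 1"
  shows "expectation (\<lambda>\<omega>. g (X i \<omega>)) = (\<integral>y. g y \<partial>measure_pmf p)"
  using integral_distr[OF X_measurable[OF assms], of g] by (simp add: distr_X[OF assms])

lemma integrable_comp_X:
  fixes g :: "nat \<Rightarrow> real"
  assumes "i \<ge> 1" "\<And>y. \<bar>g y\<bar> \<le> B"
  shows "integrable M (\<lambda>\<omega>. g (X i \<omega>))"
  by (rule integrable_const_bound[where B = B]) (use assms comp_X_measurable[of i g] in auto)

lemma expectation_product_comp_X:
  fixes g :: "nat \<Rightarrow> real"
  assumes "i \<ge> 1" "j \<ge> 1" and g: "\<And>y. \<bar>g y\<bar> \<le> B" "(\<integral>y. g y \<partial>measure_pmf p) = 0"
  shows "integrable M (\<lambda>\<omega>. g (X i \<omega>) * g (X j \<omega>))"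
    and "expectation (\<lambda>\<omega>. g (X i \<omega>) * g (X j \<omega>)) =
      (if i = j then \<integral>y. (g y)\<^sup>2 \<partial>measure_pmf p else 0)"
proof -
  have "\<bar>g x * g y\<bar> \<le> B * B" for x y
    unfolding abs_mult by (intro mult_mono g) (use g(1)[of x] in auto)
  then show "integrable M (\<lambda>\<omega>. g (X i \<omega>) * g (X j \<omega>))"
    by (intro integrable_const_bound[where B = "B * B"])
       (use assms(1,2) comp_X_measurable[of _ g] in \<open>auto intro!: borel_measurable_times\<close>)
  show "expectation (\<lambda>\<omega>. g (X i \<omega>) * g (X j \<omega>)) =
      (if i = j then \<integral>y. (g y)\<^sup>2 \<partial>measure_pmf p else 0)"
  proof (cases "i = j")
    case True
    then show ?thesis
      using expectation_comp_X[OF \<open>j \<ge> 1\<close>, of "\<lambda>y. (g y)\<^sup>2"] by (simp add: power2_eq_square)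
  next
    case False
    have "indep_vars (\<lambda>_. count_space UNIV) X {i, j}"
      by (rule indep_vars_subset[OF indep_X]) (use assms in auto)
    then have "indep_vars (\<lambda>_. borel) (\<lambda>i \<omega>. g (X i \<omega>)) {i, j}"
      by (rule indep_vars_compose2) auto
    then have "expectation (\<lambda>\<omega>. \<Prod>k\<in>{i, j}. g (X k \<omega>)) = (\<Prod>k\<in>{i, j}. expectation (\<lambda>\<omega>. g (X k \<omega>)))"
      by (intro indep_vars_lebesgue_integral) (use assms integrable_comp_X[OF _ g(1)] in auto)
    then show ?thesis
      using False expectation_comp_X[OF \<open>i \<ge> 1\<close>, of g] g(2) by simp
  qed
qed

lemma second_moment_sum_comp_X:
  fixes g :: "nat \<Rightarrow> real"
  assumes g: "\<And>y. \<bar>g y\<bar> \<le> B" "(\<integral>y. g y \<partial>measure_pmf p) = 0"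
  shows "integrable M (\<lambda>\<omega>. (\<Sum>i\<in>{1..n}. g (X i \<omega>))\<^sup>2)"
    and "expectation (\<lambda>\<omega>. (\<Sum>i\<in>{1..n}. g (X i \<omega>))\<^sup>2) = real n * (\<integral>y. (g y)\<^sup>2 \<partial>measure_pmf p)"
proof -
  have eq: "(\<lambda>\<omega>. (\<Sum>i\<in>{1..n}. g (X i \<omega>))\<^sup>2) =
      (\<lambda>\<omega>. \<Sum>i\<in>{1..n}. \<Sum>j\<in>{1..n}. g (X i \<omega>) * g (X j \<omega>))"
    by (simp add: power2_eq_square sum_product)
  show "integrable M (\<lambda>\<omega>. (\<Sum>i\<in>{1..n}. g (X i \<omega>))\<^sup>2)"
    unfolding eq
    by (intro Bochner_Integration.integrable_sum expectation_product_comp_X(1)[OF _ _ g]) auto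
  have "expectation (\<lambda>\<omega>. (\<Sum>i\<in>{1..n}. g (X i \<omega>))\<^sup>2) =
      (\<Sum>i\<in>{1..n}. \<Sum>j\<in>{1..n}. expectation (\<lambda>\<omega>. g (X i \<omega>) * g (X j \<omega>)))"
    unfolding eq
    by (subst Bochner_Integration.integral_sum Bochner_Integration.integrable_sum;
        (intro sum.cong refl Bochner_Integration.integral_sum)?;
        (intro Bochner_Integration.integrable_sum)?; intro expectation_product_comp_X(1)[OF _ _ g]; simp)
  also have "\<dots> = (\<Sum>i\<in>{1..n}. \<Sum>j\<in>{1..n}. if i = j then \<integral>y. (g y)\<^sup>2 \<partial>measure_pmf p else 0)"
    by (intro sum.cong refl expectation_product_comp_X(2)[OF _ _ g]) auto
  finally show "expectation (\<lambda>\<omega>. (\<Sum>i\<in>{1..n}. g (X i \<omega>))\<^sup>2) =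
      real n * (\<integral>y. (g y)\<^sup>2 \<partial>measure_pmf p)"
    by simp
qed

lemma central_limit_cos:
  fixes g :: "nat \<Rightarrow> real"
  assumes g: "\<And>y. \<bar>g y\<bar> \<le> B" "(\<integral>y. g y \<partial>measure_pmf p) = 0"
    and \<sigma>: "\<sigma> \<ge> 0" "(\<integral>y. (g y)\<^sup>2 \<partial>measure_pmf p) = \<sigma>\<^sup>2"
  shows "(\<lambda>n. expectation (\<lambda>\<omega>. cos (b + (\<Sum>i\<in>{1..n}. g (X i \<omega>)) / sqrt (real n))))
    \<longlonglongrightarrow> (\<integral>x. cos (b + \<sigma> * x) \<partial>std_normal_distribution)"
proof (cases "\<sigma> = 0")
  case True
  have "expectation (\<lambda>\<omega>. cos (b + (\<Sum>i\<in>{1..n}. g (X i \<omega>)) / sqrt (real n))) = cos b" for n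
  proof -
    have "AE \<omega> in M. (\<Sum>i\<in>{1..n}. g (X i \<omega>))\<^sup>2 = 0"
      using second_moment_sum_comp_X[OF g, of n] \<sigma>(2) True
      by (subst integral_nonneg_eq_0_iff_AE[symmetric]) auto
    moreover note [measurable] = sum_comp_X_measurable[of g n]
    ultimately have "expectation (\<lambda>\<omega>. cos (b + (\<Sum>i\<in>{1..n}. g (X i \<omega>)) / sqrt (real n))) = expectation (\<lambda>_. cos b)"
      by (intro integral_cong_AE) auto
    then show ?thesis by (simp add: prob_space)
  qed
  then show ?thesis
    using True prob_space.prob_space[OF prob_space_normal_density[of 1 0]] by simp
next
  case False
  then have "\<sigma> > 0" using \<sigma> by simp
  have S: "(\<Sum>i<n. g (X (Suc i) \<omega>)) = (\<Sum>i\<in>{1..n}. g (X i \<omega>))" for n \<omega>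
    by (rule sum.reindex_bij_witness[of _ "\<lambda>i. i - 1" Suc]) auto
  have [measurable]: "(\<lambda>\<omega>. \<Sum>i<n. g (X (Suc i) \<omega>)) \<in> borel_measurable M" for n
    unfolding S by (rule sum_comp_X_measurable)
  have "indep_vars (\<lambda>_. count_space UNIV) (\<lambda>i. X (Suc i)) UNIV"
    using indep_vars_subset[OF indep_X, of "range Suc"]
    by (intro indep_vars_reindex[where M' = "\<lambda>_. count_space UNIV" and f = Suc]) auto
  then have indep: "indep_vars (\<lambda>_. borel) (\<lambda>i \<omega>. g (X (Suc i) \<omega>)) UNIV"
    by (rule indep_vars_compose2) auto
  have mean: "expectation (\<lambda>\<omega>. g (X (Suc i) \<omega>)) = 0" for i
    by (simp add: expectation_comp_X g)
  have sq: "expectation (\<lambda>\<omega>. (g (X (Suc i) \<omega>))\<^sup>2) = \<sigma>\<^sup>2" for i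
    using expectation_comp_X[of "Suc i" "\<lambda>y. (g y)\<^sup>2"] \<sigma>(2) by simp
  have "weak_conv_m (\<lambda>n. distr M borel (\<lambda>\<omega>. (\<Sum>i<n. g (X (Suc i) \<omega>)) / sqrt (real n * \<sigma>\<^sup>2)))
      std_normal_distribution"
  proof (rule central_limit_theorem_zero_mean[OF indep mean \<open>\<sigma> > 0\<close>])
    show "integrable M (\<lambda>\<omega>. (g (X (Suc i) \<omega>))\<^sup>2)" for i
      using expectation_product_comp_X(1)[of "Suc i" "Suc i", OF _ _ g] by (simp add: power2_eq_square)
    show "variance (\<lambda>\<omega>. g (X (Suc i) \<omega>)) = \<sigma>\<^sup>2" for i
      by (simp add: mean sq)
    show "distr M borel (\<lambda>\<omega>. g (X (Suc i) \<omega>)) = distr (measure_pmf p) borel g" for i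
      using distr_distr[OF _ X_measurable, of g borel "Suc i"] by (simp add: distr_X comp_def)
  qed
  then have *: "(\<lambda>n. \<integral>x. cos (b + \<sigma> * x)
        \<partial>distr M borel (\<lambda>\<omega>. (\<Sum>i<n. g (X (Suc i) \<omega>)) / sqrt (real n * \<sigma>\<^sup>2)))
      \<longlonglongrightarrow> (\<integral>x. cos (b + \<sigma> * x) \<partial>std_normal_distribution)"
    by (intro weak_conv_imp_integral_bdd_continuous_conv[where B = 1] real_distribution_distr
        real_dist_normal_dist)
       (auto intro!: continuous_intros)
  have "(\<integral>x. cos (b + \<sigma> * x)
        \<partial>distr M borel (\<lambda>\<omega>. (\<Sum>i<n. g (X (Suc i) \<omega>)) / sqrt (real n * \<sigma>\<^sup>2))) =
      expectation (\<lambda>\<omega>. cos (b + (\<Sum>i\<in>{1..n}. g (X i \<omega>)) / sqrt (real n)))" for n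
    using \<open>\<sigma> > 0\<close> by (subst integral_distr) (measurable, simp add: S real_sqrt_mult)
  then show ?thesis using * by simp
qed

lemma fluctuation_empirical:
  "fluctuation (empirical X) p n \<omega> x = (\<Sum>i\<in>{1..n}. indicator {x} (X i \<omega>) - pmf p x) / sqrt (real n)"
proof -
  have "(\<Sum>i\<in>{1..n}. indicator {x} (X i \<omega>) :: real) = real (card {i \<in> {1..n}. X i \<omega> = x})"
    by (simp add: indicator_def sum.If_cases Int_def flip: of_bool_def)
  then have "(\<Sum>i\<in>{1..n}. indicator {x} (X i \<omega>) - pmf p x) = real (card {i \<in> {1..n}. X i \<omega> = x}) - n * pmf p x"
    by (simp add: sum_subtractf)
  moreover have "sqrt (real n) * (c / real n - q) = (c - real n * q) / sqrt (real n)" if "n > 0" for c q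
  proof -
    have "t * (c / (t * t) - q) = (c - t * t * q) / t" if "t > 0" for t :: real
      using that by (simp add: field_simps)
    from this[of "sqrt (real n)"] show ?thesis using that by simp
  qed
  ultimately show ?thesis
    by (cases "n = 0") (simp_all add: fluctuation_def empirical_def)
qed

lemma sum_fluctuation_empirical:
  "(\<Sum>x\<in>J. a x * fluctuation (empirical X) p n \<omega> x) =
    (\<Sum>i\<in>{1..n}. projection_score p J a (X i \<omega>)) / sqrt (real n)"
  unfolding fluctuation_empirical projection_score_def
  by (subst sum.swap) (simp add: sum_distrib_left sum_divide_distrib)

lemma fluctuation_empirical_measurable:
  "(\<lambda>\<omega>. fluctuation (empirical X) p n \<omega> x) \<in> borel_measurable M"
  unfolding fluctuation_empirical
  by (intro borel_measurable_divide sum_comp_X_measurable borel_measurable_const)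

lemma fluctuation_empirical_second_moment:
  "integrable M (\<lambda>\<omega>. (fluctuation (empirical X) p n \<omega> x)\<^sup>2)"
  "expectation (\<lambda>\<omega>. (fluctuation (empirical X) p n \<omega> x)\<^sup>2) \<le> pmf p x"
proof -
  have eq: "(\<lambda>\<omega>. (fluctuation (empirical X) p n \<omega> x)\<^sup>2) =
      (\<lambda>\<omega>. (\<Sum>i\<in>{1..n}. projection_score p {x} (\<lambda>_. 1) (X i \<omega>))\<^sup>2 / real n)"
    using sum_fluctuation_empirical[where a = "\<lambda>_. 1" and J = "{x}" and n = n] by (simp add: power_divide)
  note * = second_moment_sum_comp_X[where n = n and g = "projection_score p {x} (\<lambda>_. 1)",
    OF projection_score_bounded projection_score_mean]
  show "integrable M (\<lambda>\<omega>. (fluctuation (empirical X) p n \<omega> x)\<^sup>2)"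
    unfolding eq by (intro integrable_divide *(1))
  show "expectation (\<lambda>\<omega>. (fluctuation (empirical X) p n \<omega> x)\<^sup>2) \<le> pmf p x"
    unfolding eq using *(2)
    by (cases "n = 0") (auto simp: projection_score_variance)
qed

lemma prob_empirical_deviation_le:
  assumes "n > 0" "\<epsilon> > 0"
  shows "{\<omega> \<in> space M. \<exists>x. \<bar>empirical X n \<omega> x - pmf p x\<bar> \<ge> \<epsilon>} \<in> events"
    and "prob {\<omega> \<in> space M. \<exists>x. \<bar>empirical X n \<omega> x - pmf p x\<bar> \<ge> \<epsilon>} \<le> 1 / (real n * \<epsilon>\<^sup>2)"
proof -
  let ?V = "fluctuation (empirical X) p n"
  define A where "A x = {\<omega> \<in> space M. (?V \<omega> x)\<^sup>2 \<ge> real n * \<epsilon>\<^sup>2}" for x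
  have A: "A x \<in> events" for x
    unfolding A_def using fluctuation_empirical_measurable[of n x] by measurable
  have A_iff: "(?V \<omega> x)\<^sup>2 \<ge> real n * \<epsilon>\<^sup>2 \<longleftrightarrow> \<bar>empirical X n \<omega> x - pmf p x\<bar> \<ge> \<epsilon>" for \<omega> x
    using assms abs_le_square_iff[of \<epsilon> "empirical X n \<omega> x - pmf p x"]
    by (simp add: fluctuation_def power_mult_distrib)
  have U: "{\<omega> \<in> space M. \<exists>x. \<bar>empirical X n \<omega> x - pmf p x\<bar> \<ge> \<epsilon>} = (\<Union>x. A x)"
    by (auto simp: A_def A_iff)
  show "{\<omega> \<in> space M. \<exists>x. \<bar>empirical X n \<omega> x - pmf p x\<bar> \<ge> \<epsilon>} \<in> events"
    unfolding U using A by auto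
  have "(\<lambda>x. measure (measure_pmf p) {x}) sums measure (measure_pmf p) (\<Union>x. {x})"
    by (rule measure_pmf.finite_measure_UNION) (auto simp: disjoint_family_on_def)
  then have sums: "(\<lambda>x. pmf p x / (real n * \<epsilon>\<^sup>2)) sums (1 / (real n * \<epsilon>\<^sup>2))"
    by (intro sums_divide) (simp add: measure_pmf_single)
  have le: "prob (A x) \<le> pmf p x / (real n * \<epsilon>\<^sup>2)" for x
  proof -
    have "prob (A x) \<le> expectation (\<lambda>\<omega>. (?V \<omega> x)\<^sup>2) / (real n * \<epsilon>\<^sup>2)"
      unfolding A_def
      by (rule integral_Markov_inequality_measure[where A = "{}"])
         (use assms fluctuation_empirical_second_moment in auto)
    also have "\<dots> \<le> pmf p x / (real n * \<epsilon>\<^sup>2)"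
      by (intro divide_right_mono fluctuation_empirical_second_moment) auto
    finally show ?thesis .
  qed
  have summable: "summable (\<lambda>x. prob (A x))"
    by (rule summable_comparison_test'[OF sums_summable[OF sums], of 0]) (use le in auto)
  have "prob (\<Union>x. A x) \<le> (\<Sum>x. prob (A x))"
    by (rule finite_measure_subadditive_countably) (use A summable in auto)
  also have "\<dots> \<le> (\<Sum>x. pmf p x / (real n * \<epsilon>\<^sup>2))"
    by (intro suminf_le le summable sums_summable[OF sums])
  finally show "prob {\<omega> \<in> space M. \<exists>x. \<bar>empirical X n \<omega> x - pmf p x\<bar> \<ge> \<epsilon>} \<le> 1 / (real n * \<epsilon>\<^sup>2)"
    unfolding U sums_unique[OF sums, symmetric] .
qed

lemma empirical_vector_measurable: "empirical_vector X n \<in> M \<rightarrow>\<^sub>M count_space UNIV"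
proof -
  define sample where "sample n \<omega> = map (\<lambda>i. X i \<omega>) [1..<Suc n]" for n \<omega>
  have "sample n \<in> M \<rightarrow>\<^sub>M count_space UNIV"
  proof (induction n)
    case 0
    then show ?case by (simp add: sample_def)
  next
    case (Suc n)
    have "(\<lambda>\<omega>. (\<lambda>(l, x). l @ [x]) (sample n \<omega>, X (Suc n) \<omega>)) \<in> M \<rightarrow>\<^sub>M count_space UNIV"
    proof (rule measurable_compose[of _ _ "count_space UNIV \<Otimes>\<^sub>M count_space UNIV"])
      show "(\<lambda>\<omega>. (sample n \<omega>, X (Suc n) \<omega>)) \<in> M \<rightarrow>\<^sub>M count_space UNIV \<Otimes>\<^sub>M count_space UNIV"
        using Suc X_measurable[of "Suc n"] by (intro measurable_Pair) auto
    qed (simp add: pair_measure_countable)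
    moreover have "sample (Suc n) = (\<lambda>\<omega>. (\<lambda>(l, x). l @ [x]) (sample n \<omega>, X (Suc n) \<omega>))"
      by (simp add: sample_def fun_eq_iff)
    ultimately show ?case by simp
  qed
  moreover have "empirical_vector X n =
      (\<lambda>\<omega>. empirical_vector (\<lambda>i l. l ! (i - 1)) n (sample n \<omega>))"
  proof
    fix \<omega>
    have nth: "sample n \<omega> ! (i - 1) = X i \<omega>" if "i \<in> {1..n}" for i
    proof -
      have "[1..<Suc n] ! (i - 1) = i" "i - 1 < length [1..<Suc n]"
        using that by (auto simp del: upt_Suc)
      then show ?thesis unfolding sample_def by (simp del: upt_Suc)
    qed
    have "(\<lambda>i. X i \<omega>) ` {1..n} = (\<lambda>i. sample n \<omega> ! (i - 1)) ` {1..n}"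
      using nth by (intro image_cong) auto
    moreover have "{i \<in> {1..n}. X i \<omega> = x} = {i \<in> {1..n}. sample n \<omega> ! (i - 1) = x}" for x
      using nth by auto
    ultimately show "empirical_vector X n \<omega> = empirical_vector (\<lambda>i l. l ! (i - 1)) n (sample n \<omega>)"
      unfolding empirical_vector_def empirical_def by simp
  qed
  ultimately show ?thesis
    using measurable_compose[of "sample n" M "count_space UNIV"
      "empirical_vector (\<lambda>i l. l ! (i - 1)) n" "count_space UNIV"] by simp
qed

end

context prob_space
begin

lemma gaussian_variable_square_integrable:
  assumes "gaussian_variable U"
  shows "integrable M U" "integrable M (\<lambda>\<omega>. (U \<omega>)\<^sup>2)"
proof -
  have U [measurable]: "U \<in> borel_measurable M"
    using assms by (simp add: gaussian_variable_def)
  show *: "integrable M (\<lambda>\<omega>. (U \<omega>)\<^sup>2)"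
    using assms unfolding gaussian_variable_def
  proof (elim conjE disjE exE)
    fix \<mu> \<sigma> :: real assume D: "0 < \<sigma>" "distributed M lborel U (normal_density \<mu> \<sigma>)"
    have "integrable lborel (\<lambda>x. normal_density \<mu> \<sigma> x * (x - \<mu>)^2)"
      "integrable lborel (\<lambda>x. normal_density \<mu> \<sigma> x * (x - \<mu>)^1)"
      by (rule integrable_normal_moment[OF D(1)])+
    then have "integrable lborel (\<lambda>x. normal_density \<mu> \<sigma> x * (x - \<mu>)^2 +
        2 * \<mu> * (normal_density \<mu> \<sigma> x * (x - \<mu>)^1) + \<mu>\<^sup>2 * normal_density \<mu> \<sigma> x)"
      using D(1) by simp
    also have "(\<lambda>x. normal_density \<mu> \<sigma> x * (x - \<mu>)^2 +
        2 * \<mu> * (normal_density \<mu> \<sigma> x * (x - \<mu>)^1) + \<mu>\<^sup>2 * normal_density \<mu> \<sigma> x) =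
        (\<lambda>x. normal_density \<mu> \<sigma> x * x\<^sup>2)"
      by (simp add: fun_eq_iff power2_eq_square algebra_simps)
    finally show ?thesis
      using distributed_integrable[OF D(2), of "\<lambda>x. x\<^sup>2"] by simp
  next
    fix \<mu> assume "AE \<omega> in M. U \<omega> = \<mu>"
    then show ?thesis
      by (subst integrable_cong_AE[of _ _ "\<lambda>_. \<mu>\<^sup>2"]) auto
  qed
  show "integrable M U"
    by (rule square_integrable_imp_integrable[OF U *])
qed

lemma gaussian_variable_expectation_cos:
  assumes "gaussian_variable U" "expectation U = 0" "expectation (\<lambda>\<omega>. (U \<omega>)\<^sup>2) = \<sigma>\<^sup>2" "\<sigma> \<ge> 0"
  shows "expectation (\<lambda>\<omega>. cos (b + U \<omega>)) = (\<integral>x. cos (b + \<sigma> * x) \<partial>std_normal_distribution)"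
  using assms(1) unfolding gaussian_variable_def
proof (elim conjE disjE exE)
  fix \<mu> s :: real assume D: "0 < s" "distributed M lborel U (normal_density \<mu> s)"
  have "\<mu> = 0"
    using normal_distributed_expectation[OF D] assms(2) by simp
  have "s\<^sup>2 = \<sigma>\<^sup>2"
    using normal_distributed_variance[OF D] assms(2,3) by simp
  then have "s = \<sigma>" using D(1) assms(4) by (simp add: power2_eq_iff_nonneg)
  have std: "distributed M lborel (\<lambda>\<omega>. U \<omega> / \<sigma>) std_normal_density"
    using normal_standard_normal_convert[OF D(1), of U \<mu>] D(2) unfolding \<open>\<mu> = 0\<close> \<open>s = \<sigma>\<close> by simp
  have "(\<integral>x. std_normal_density x * cos (b + \<sigma> * x) \<partial>lborel) = expectation (\<lambda>\<omega>. cos (b + \<sigma> * (U \<omega> / \<sigma>)))"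
    by (rule distributed_integral[OF std]) auto
  then show ?thesis
    using D(1) \<open>s = \<sigma>\<close> by (simp add: integral_density)
next
  fix \<mu> assume U [measurable]: "U \<in> borel_measurable M" and \<mu>: "AE \<omega> in M. U \<omega> = \<mu>"
  have c: "expectation (\<lambda>\<omega>. h (U \<omega>)) = h \<mu>" if "h \<in> borel_measurable borel" for h :: "real \<Rightarrow> real"
  proof -
    have "expectation (\<lambda>\<omega>. h (U \<omega>)) = expectation (\<lambda>_. h \<mu>)"
      using that \<mu> by (intro integral_cong_AE) auto
    then show ?thesis by (simp add: prob_space)
  qed
  have "\<mu> = 0" "\<sigma> = 0"
    using c[of "\<lambda>x. x"] c[of "\<lambda>x. x\<^sup>2"] assms by auto
  then show ?thesis
    using c[of "\<lambda>x. cos (b + x)"] prob_space.prob_space[OF prob_space_normal_density[of 1 0]] by simp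
qed

lemma gaussian_process_variable:
  assumes "gaussian_process Y"
  shows "gaussian_variable (Y x)"
proof -
  have "gaussian_variable (\<lambda>\<omega>. \<Sum>x\<in>{x}. 1 * Y x \<omega>)"
    using assms[unfolded gaussian_process_def, rule_format, of "{x}" "\<lambda>_. 1"] by simp
  then show ?thesis by simp
qed

lemma gaussian_process_expectation_cos:
  assumes Y: "gaussian_process Y" "\<And>x. expectation (Y x) = 0" and "finite J" "\<sigma> \<ge> 0"
    and \<sigma>: "(\<Sum>x\<in>J. \<Sum>x'\<in>J. a x * a x' * covariance (Y x) (Y x')) = \<sigma>\<^sup>2"
  shows "expectation (\<lambda>\<omega>. cos (b + (\<Sum>x\<in>J. a x * Y x \<omega>))) =
    (\<integral>x. cos (b + \<sigma> * x) \<partial>std_normal_distribution)"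
proof (rule gaussian_variable_expectation_cos[OF _ _ _ \<open>\<sigma> \<ge> 0\<close>])
  note Yi = gaussian_variable_square_integrable[OF gaussian_process_variable[OF Y(1)]]
  have [measurable]: "Y x \<in> borel_measurable M" for x
    using Yi(1) by auto
  have prod: "integrable M (\<lambda>\<omega>. Y x \<omega> * Y x' \<omega>)" for x x'
  proof (rule Bochner_Integration.integrable_bound)
    show "integrable M (\<lambda>\<omega>. (Y x \<omega>)\<^sup>2 + (Y x' \<omega>)\<^sup>2)"
      using Yi(2) by simp
    have "\<bar>u * v\<bar> \<le> u\<^sup>2 + v\<^sup>2" for u v :: real
    proof -
      have "\<bar>u * v\<bar> \<le> 2 * \<bar>u\<bar> * \<bar>v\<bar>" by (simp add: abs_mult)
      also have "\<dots> \<le> u\<^sup>2 + v\<^sup>2" using sum_squares_bound[of "\<bar>u\<bar>" "\<bar>v\<bar>"] by simp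
      finally show ?thesis .
    qed
    then show "AE \<omega> in M. norm (Y x \<omega> * Y x' \<omega>) \<le> norm ((Y x \<omega>)\<^sup>2 + (Y x' \<omega>)\<^sup>2)"
      by simp
  qed measurable
  show "gaussian_variable (\<lambda>\<omega>. \<Sum>x\<in>J. a x * Y x \<omega>)"
    using Y(1) \<open>finite J\<close> by (simp add: gaussian_process_def)
  show "expectation (\<lambda>\<omega>. \<Sum>x\<in>J. a x * Y x \<omega>) = 0"
    using Yi(1) by (simp add: Y(2))
  have "(\<lambda>\<omega>. (\<Sum>x\<in>J. a x * Y x \<omega>)\<^sup>2) = (\<lambda>\<omega>. \<Sum>x\<in>J. \<Sum>x'\<in>J. a x * a x' * (Y x \<omega> * Y x' \<omega>))"
    by (simp add: power2_eq_square sum_product mult_ac)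
  then show "expectation (\<lambda>\<omega>. (\<Sum>x\<in>J. a x * Y x \<omega>)\<^sup>2) = \<sigma>\<^sup>2"
    using prod by (simp add: covariance_def Y(2) flip: \<sigma>)
qed

end

subsection \<open>Convergence of the estimators\<close>

lemma (in iid_sample) converges_in_distribution_isotone_operator:
  fixes N :: "'b measure" and Y :: "nat \<Rightarrow> 'b \<Rightarrow> real" and r s :: nat
  assumes "isotone_operator F"
    and antimono: "\<And>x. pmf p x \<ge> pmf p (x + 1)"
    and rs: "r \<le> s"
    and left: "r > 0 \<Longrightarrow> pmf p (r - 1) > pmf p r"
    and const: "\<And>x. x \<in> {r..s} \<Longrightarrow> pmf p x = pmf p r"
    and right: "pmf p s > pmf p (s + 1)"
    and N: "prob_space N"
    and Y: "prob_space.gaussian_process N Y" "\<And>x. prob_space.expectation N (Y x) = 0"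
    and cov: "\<And>x x'. prob_space.covariance N (Y x) (Y x') =
           pmf p x * (if x = x' then 1 else 0) - pmf p x * pmf p x'"
  shows "converges_in_distribution {r..s}
           M (\<lambda>n \<omega>. segment r s (fluctuation (\<lambda>n \<omega>. nth_default 0 (F (empirical_vector X n \<omega>))) p n \<omega>))
           N (\<lambda>\<omega>. on_segment F r s (\<lambda>x. Y x \<omega>))"
proof -
  interpret isotone_operator F by fact
  interpret N: prob_space N by fact
  let ?Z = "\<lambda>n \<omega>. segment r s (fluctuation (\<lambda>n \<omega>. nth_default 0 (F (empirical_vector X n \<omega>))) p n \<omega>)"
  let ?V = "fluctuation (empirical X) p"
  let ?Y = "\<lambda>\<omega> x. Y x \<omega>"
  have Y_sq: "integrable N (Y x)" "integrable N (\<lambda>\<omega>. (Y x \<omega>)\<^sup>2)" for x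
    by (intro N.gaussian_variable_square_integrable N.gaussian_process_variable Y)+
  have Y_meas: "Y x \<in> borel_measurable N" for x
    using Y_sq(1) by (rule borel_measurable_integrable)
  have on_segment_space: "on_segment F r s v \<in> (\<Pi>\<^sub>E i\<in>{r..s}. UNIV)" for v
    by (auto simp: on_segment_def)
  have Z_meas: "?Z n \<in> M \<rightarrow>\<^sub>M PiM {r..s} (\<lambda>_. borel)"
    and fZ_meas: "(\<lambda>\<omega>. f (?Z n \<omega>)) \<in> borel_measurable M" for n and f :: "(nat \<Rightarrow> real) \<Rightarrow> real"
  proof -
    define H where "H w = segment r s (\<lambda>x. sqrt (real n) * (nth_default 0 (F w) x - pmf p x))" for w
    have H: "?Z n = (\<lambda>\<omega>. H (empirical_vector X n \<omega>))"
      by (simp add: H_def fluctuation_def[abs_def])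
    show "?Z n \<in> M \<rightarrow>\<^sub>M PiM {r..s} (\<lambda>_. borel)"
      unfolding H by (rule measurable_compose[OF empirical_vector_measurable])
        (auto simp: H_def segment_def space_PiM)
    have "(\<lambda>\<omega>. f (H (empirical_vector X n \<omega>))) \<in> borel_measurable M"
      by (rule measurable_compose[OF empirical_vector_measurable, of "\<lambda>w. f (H w)"]) simp
    then show "(\<lambda>\<omega>. f (?Z n \<omega>)) \<in> borel_measurable M"
      using fun_cong[OF H] by simp
  qed
  have Y_limit_meas: "(\<lambda>\<omega>. on_segment F r s (?Y \<omega>)) \<in> N \<rightarrow>\<^sub>M PiM {r..s} (\<lambda>_. borel)"
  proof (rule measurable_PiM_single')
    have Yb: "?Y \<in> borel_measurable N"
      by (rule measurable_coordinatewise_then_product) (rule Y_meas)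
    fix x assume x: "x \<in> {r..s}"
    show "(\<lambda>\<omega>. on_segment F r s (?Y \<omega>) x) \<in> borel_measurable N"
      using measurable_compose[OF Yb borel_measurable_continuous_onI[OF continuous_on_F_nth[OF x]]] x
      by (simp add: on_segment_def del: upt_Suc)
  qed (auto simp: on_segment_def)
  have "(\<lambda>n. \<integral>\<omega>. f (?Z n \<omega>) \<partial>M) \<longlonglongrightarrow> (\<integral>\<omega>. f (on_segment F r s (?Y \<omega>)) \<partial>N)"
    if f: "continuous_map (product_topology (\<lambda>_. euclideanreal) {r..s}) euclideanreal f"
      "bounded (f ` (\<Pi>\<^sub>E i\<in>{r..s}. UNIV))" for f
  proof -
    obtain B where B: "\<And>v. v \<in> (\<Pi>\<^sub>E i\<in>{r..s}. UNIV) \<Longrightarrow> \<bar>f v\<bar> \<le> B"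
      using f(2) by (auto simp: bounded_iff)
    define f' where "f' v = f (on_segment F r s v)" for v
    have cont: "continuous_on UNIV f'"
      using continuous_map_compose[OF continuous_map_on_segment f(1)] by (simp add: f'_def[abs_def] comp_def)
    have f'_B: "\<bar>f' v\<bar> \<le> B" for v
      unfolding f'_def by (intro B on_segment_space)
    have f'_cong: "f' u = f' v" if "\<And>i. i \<in> {r..s} \<Longrightarrow> u i = v i" for u v
    proof -
      have "map u [r..<Suc s] = map v [r..<Suc s]"
        using that by (intro map_cong refl) auto
      then show ?thesis by (simp only: f'_def on_segment_def)
    qed
    have lim: "(\<lambda>n. expectation (\<lambda>\<omega>. f' (?V n \<omega>))) \<longlonglongrightarrow> (\<integral>\<omega>. f' (?Y \<omega>) \<partial>N)"
    proof (rule Cramer_Wold[where J = "{r..s}" and C = 1 and B = B and Z = ?V and Z' = ?Y])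
      show "expectation (\<lambda>\<omega>. (?V n \<omega> x)\<^sup>2) \<le> 1" for n x
        using fluctuation_empirical_second_moment(2)[of n x] pmf_le_1[of p x] by linarith
      show "(\<integral>\<omega>. (Y x \<omega>)\<^sup>2 \<partial>N) \<le> 1" for x
      proof -
        have "(\<integral>\<omega>. (Y x \<omega>)\<^sup>2 \<partial>N) = pmf p x - pmf p x * pmf p x"
          using cov[of x x] by (simp add: N.covariance_def Y(2) power2_eq_square)
        also have "\<dots> \<le> pmf p x" by simp
        finally show ?thesis using pmf_le_1[of p x] by linarith
      qed
      fix a b
      define \<sigma> where "\<sigma> = sqrt (\<integral>y. (projection_score p {r..s} a y)\<^sup>2 \<partial>measure_pmf p)"
      have \<sigma>: "\<sigma> \<ge> 0" "(\<integral>y. (projection_score p {r..s} a y)\<^sup>2 \<partial>measure_pmf p) = \<sigma>\<^sup>2"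
        by (simp_all add: \<sigma>_def)
      have "(\<integral>\<omega>. cos (b + (\<Sum>x\<in>{r..s}. a x * Y x \<omega>)) \<partial>N) =
          (\<integral>x. cos (b + \<sigma> * x) \<partial>std_normal_distribution)"
        using \<sigma>(2) unfolding projection_score_variance cov[symmetric]
        by (intro N.gaussian_process_expectation_cos Y \<sigma>(1)) auto
      then show "(\<lambda>n. expectation (\<lambda>\<omega>. cos (b + (\<Sum>x\<in>{r..s}. a x * ?V n \<omega> x))))
          \<longlonglongrightarrow> (\<integral>\<omega>. cos (b + (\<Sum>x\<in>{r..s}. a x * Y x \<omega>)) \<partial>N)"
        unfolding sum_fluctuation_empirical
        using central_limit_cos[OF projection_score_bounded projection_score_mean \<sigma>, of b] by simp
    qed (rule prob_space_axioms N finite_atLeastAtMost fluctuation_empirical_measurable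
        fluctuation_empirical_second_moment(1) Y_meas Y_sq(2) cont f'_B | erule f'_cong)+
    obtain \<epsilon> where \<epsilon>: "\<epsilon> > 0" "r > 0 \<Longrightarrow> pmf p r + 2 * \<epsilon> \<le> pmf p (r - 1)"
      "pmf p (s + 1) + 2 * \<epsilon> \<le> pmf p s"
    proof -
      let ?e = "min (if r > 0 then pmf p (r - 1) - pmf p r else 1) (pmf p s - pmf p (s + 1)) / 2"
      have "?e > 0" "r > 0 \<Longrightarrow> pmf p r + 2 * ?e \<le> pmf p (r - 1)" "pmf p (s + 1) + 2 * ?e \<le> pmf p s"
        using left right by (auto simp: min_def)
      then show ?thesis using that by blast
    qed
    have diff: "\<bar>expectation (\<lambda>\<omega>. f (?Z n \<omega>)) - expectation (\<lambda>\<omega>. f' (?V n \<omega>))\<bar>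
        \<le> 2 * B / \<epsilon>\<^sup>2 / real n" if n: "n > 0" for n
    proof -
      define bad where "bad = {\<omega> \<in> space M. \<exists>x. \<bar>empirical X n \<omega> x - pmf p x\<bar> \<ge> \<epsilon>}"
      note bad = prob_empirical_deviation_le[OF n \<epsilon>(1), folded bad_def]
      have fZ_B: "\<bar>f (?Z n \<omega>)\<bar> \<le> B" for \<omega>
        by (rule B) (auto simp: segment_def)
      have V_meas: "?V n \<in> borel_measurable M"
        by (rule measurable_coordinatewise_then_product) (rule fluctuation_empirical_measurable)
      note f'V_meas = measurable_compose[OF V_meas borel_measurable_continuous_onI[OF cont]]
      have int: "integrable M (\<lambda>\<omega>. f (?Z n \<omega>))" "integrable M (\<lambda>\<omega>. f' (?V n \<omega>))"
        by (rule integrable_const_bound[where B = B]; use fZ_B f'_B fZ_meas f'V_meas in simp)+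
      have pw: "\<bar>f (?Z n \<omega>) - f' (?V n \<omega>)\<bar> \<le> 2 * B * indicator bad \<omega>" if "\<omega> \<in> space M" for \<omega>
      proof (cases "\<omega> \<in> bad")
        case True
        then show ?thesis using fZ_B[of \<omega>] f'_B[of "?V n \<omega>"] by (simp add: abs_le_iff)
      next
        case False
        then have "\<bar>empirical X n \<omega> x - pmf p x\<bar> < \<epsilon>" for x
          using that by (auto simp: bad_def not_le)
        then have "?Z n \<omega> = on_segment F r s (?V n \<omega>)"
          by (intro segment_fluctuation_eq[where \<epsilon> = \<epsilon>] antimono rs \<epsilon> const n assms(1))
        then show ?thesis using False by (simp add: f'_def)
      qed
      have "\<bar>expectation (\<lambda>\<omega>. f (?Z n \<omega>)) - expectation (\<lambda>\<omega>. f' (?V n \<omega>))\<bar>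
          = \<bar>expectation (\<lambda>\<omega>. f (?Z n \<omega>) - f' (?V n \<omega>))\<bar>"
        using int by simp
      also have "\<dots> \<le> expectation (\<lambda>\<omega>. \<bar>f (?Z n \<omega>) - f' (?V n \<omega>)\<bar>)"
        by (rule integral_abs_bound)
      also have "\<dots> \<le> expectation (\<lambda>\<omega>. 2 * B * indicator bad \<omega>)"
        using int pw bad(1) by (intro integral_mono) (auto simp: less_top[symmetric])
      also have "\<dots> = 2 * B * prob bad"
        using bad(1) by simp
      also have "\<dots> \<le> 2 * B * (1 / (real n * \<epsilon>\<^sup>2))"
        using bad(2) f'_B[of undefined] by (intro mult_left_mono) auto
      finally show ?thesis by (simp add: mult_ac)
    qed
    have "(\<lambda>n. 2 * B / \<epsilon>\<^sup>2 / real n) \<longlonglongrightarrow> 0"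
      by (intro tendsto_divide_0[OF tendsto_const] filterlim_at_top_imp_at_infinity
          filterlim_real_sequentially)
    then have "(\<lambda>n. expectation (\<lambda>\<omega>. f (?Z n \<omega>)) - expectation (\<lambda>\<omega>. f' (?V n \<omega>))) \<longlonglongrightarrow> 0"
      by (rule Lim_null_comparison[rotated])
         (use diff in \<open>auto simp: eventually_sequentially intro!: exI[of _ 1]\<close>)
    from tendsto_add[OF this lim] show ?thesis
      by (simp add: f'_def)
  qed
  then show ?thesis
    unfolding converges_in_distribution_def using Z_meas Y_limit_meas by blast
qed

theorem proposition3p3:
  fixes M :: "'a measure" and X :: "nat \<Rightarrow> 'a \<Rightarrow> nat" and p :: "nat pmf"
    and N :: "'b measure" and Y :: "nat \<Rightarrow> 'b \<Rightarrow> real" and r s :: nat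
  assumes "prob_space M"
    and "prob_space.indep_vars M (\<lambda>_. count_space UNIV) X {1..}"
    and "\<And>i. i \<ge> 1 \<Longrightarrow> distr M (count_space UNIV) (X i) = measure_pmf p"
    and "\<And>x. pmf p x \<ge> pmf p (x + 1)"
    and "s - r \<ge> 1"
    and "r > 0 \<Longrightarrow> pmf p (r - 1) > pmf p r"
    and "\<And>x. x \<in> {r..s} \<Longrightarrow> pmf p x = pmf p r"
    and "pmf p s > pmf p (s + 1)"
    and "prob_space N"
    and "prob_space.gaussian_process N Y"
    and "\<And>x. prob_space.expectation N (Y x) = 0"
    and "\<And>x x'. prob_space.covariance N (Y x) (Y x') =
           pmf p x * (if x = x' then 1 else 0) - pmf p x * pmf p x'"
    and "AE \<omega> in N. summable (\<lambda>x. (Y x \<omega>)\<^sup>2)"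
  shows "converges_in_distribution {r..s}
           M (\<lambda>n \<omega>. segment r s (fluctuation (rearrangement_estimator X) p n \<omega>))
           N (\<lambda>\<omega>. on_segment rear r s (\<lambda>x. Y x \<omega>))
       \<and> converges_in_distribution {r..s}
           M (\<lambda>n \<omega>. segment r s (fluctuation (grenander_estimator X) p n \<omega>))
           N (\<lambda>\<omega>. on_segment gren r s (\<lambda>x. Y x \<omega>))"
proof -
  interpret iid_sample M X p
    using assms(1-3) by (intro iid_sample.intro iid_sample_axioms.intro)
  have "r \<le> s" using assms(5) by simp
  note convergence = converges_in_distribution_isotone_operator[OF _ assms(4) this assms(6-12)]
  show ?thesis
    unfolding rearrangement_estimator_def[abs_def] grenander_estimator_def[abs_def]
    by (intro conjI convergence rear.isotone_operator_axioms gren.isotone_operator_axioms)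
qed

end
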